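(* For every integer $n\ge 1$ there exists a polynomial potential system of degree $n$, that is, a planar system $$\dot x=y,\qquad \dot y=-g(x),$$ with $g\in\mathbb{R}[x]$ a polynomial of degree $n$, having a center at the origin, such that the number of critical periods of the period annulus around the origin is at least $n-2$.
   Context: The period annulus around a center is the maximal punctured neighbourhood of the center filled with periodic orbits. Parameterizing its periodic orbits by a real number $h$ (through a global smooth transversal section, or, for a Hamiltonian system, by the value $h$ of the Hamiltonian), the period function $T(h)$ assigns to each periodic orbit its minimal period. If the period function is not monotone (in particular, not constant), its local maxima and local minima are called critical periods; the number of critical periods is the number of such local extrema, and it does not depend on the choice of section or parametrization. *)

theory Defs
  imports "HOL-Analysis.Analysis" "HOL-Computational_Algebra.Polynomial"
    "HOL-Library.Extended_Nat"
begin

section \<open>Periodic orbits, centers and period annuli of planar systems\<close>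

definition is_solution :: "(real \<times> real \<Rightarrow> real \<times> real) \<Rightarrow> (real \<Rightarrow> real \<times> real) \<Rightarrow> bool" where
  "is_solution F u \<longleftrightarrow> (\<forall>t. (u has_vector_derivative F (u t)) (at t))"

text \<open>Equilibria have no minimal period, since every positive number is a period of a
  constant solution; conversely, every nonconstant periodic solution has one.\<close>

definition minimal_period :: "(real \<Rightarrow> real \<times> real) \<Rightarrow> real \<Rightarrow> bool" where
  "minimal_period u \<tau> \<longleftrightarrow> 0 < \<tau> \<and> (\<forall>t. u (t + \<tau>) = u t) \<and>
     (\<forall>s. 0 < s \<and> s < \<tau> \<longrightarrow> \<not> (\<forall>t. u (t + s) = u t))"

definition periodic_orbit :: "(real \<times> real \<Rightarrow> real \<times> real) \<Rightarrow> (real \<times> real) set \<Rightarrow> bool" where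
  "periodic_orbit F \<gamma> \<longleftrightarrow> (\<exists>u \<tau>. is_solution F u \<and> minimal_period u \<tau> \<and> range u = \<gamma>)"

definition orbit_period :: "(real \<times> real \<Rightarrow> real \<times> real) \<Rightarrow> (real \<times> real) set \<Rightarrow> real" where
  "orbit_period F \<gamma> = (THE \<tau>. \<exists>u. is_solution F u \<and> range u = \<gamma> \<and> minimal_period u \<tau>)"

text \<open>Connectedness matters for the maximal such neighbourhood: without it, annuli of
  periodic orbits lying beyond a separatrix cycle would be added to the period annulus.\<close>

definition periodic_nbhd ::
    "(real \<times> real \<Rightarrow> real \<times> real) \<Rightarrow> real \<times> real \<Rightarrow> (real \<times> real) set \<Rightarrow> bool" where
  "periodic_nbhd F p U \<longleftrightarrow> open U \<and> connected U \<and> p \<in> U \<and>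
     (\<forall>q\<in>U - {p}. \<exists>\<gamma>. periodic_orbit F \<gamma> \<and> q \<in> \<gamma> \<and> \<gamma> \<subseteq> U - {p})"

definition is_center :: "(real \<times> real \<Rightarrow> real \<times> real) \<Rightarrow> real \<times> real \<Rightarrow> bool" where
  "is_center F p \<longleftrightarrow> F p = 0 \<and> (\<exists>U. periodic_nbhd F p U)"

text \<open>If \<open>p\<close> is a center, the union is itself a \<open>periodic_nbhd\<close>, hence the largest one.\<close>

definition period_annulus ::
    "(real \<times> real \<Rightarrow> real \<times> real) \<Rightarrow> real \<times> real \<Rightarrow> (real \<times> real) set" where
  "period_annulus F p = \<Union>{U. periodic_nbhd F p U} - {p}"


section \<open>Potential systems and their critical periods\<close>

definition potential_field :: "real poly \<Rightarrow> real \<times> real \<Rightarrow> real \<times> real" where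
  "potential_field g = (\<lambda>(x, y). (y, - poly g x))"

text \<open>\<open>H(x, y) = y\<^sup>2/2 + G(x)\<close>, where \<open>G\<close> is the primitive of \<open>g\<close> with \<open>G(0) = 0\<close>.\<close>

definition hamiltonian :: "real poly \<Rightarrow> real \<times> real \<Rightarrow> real" where
  "hamiltonian g = (\<lambda>(x, y). y\<^sup>2 / 2 + (\<Sum>i\<le>degree g. coeff g i * x ^ Suc i / real (Suc i)))"

text \<open>The energies of the periodic orbits in the period annulus around the origin. On that
  annulus each energy is attained on exactly one periodic orbit.\<close>

definition energies :: "real poly \<Rightarrow> real set" where
  "energies g = hamiltonian g ` period_annulus (potential_field g) 0"

definition orbit_of_energy :: "real poly \<Rightarrow> real \<Rightarrow> (real \<times> real) set" where
  "orbit_of_energy g h = (THE \<gamma>. periodic_orbit (potential_field g) \<gamma> \<and>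
     \<gamma> \<subseteq> period_annulus (potential_field g) 0 \<and> (\<forall>q\<in>\<gamma>. hamiltonian g q = h))"

definition period_function :: "real poly \<Rightarrow> real \<Rightarrow> real" where
  "period_function g h = orbit_period (potential_field g) (orbit_of_energy g h)"

text \<open>The period function is real analytic, so when it is not monotone its local extrema are
  isolated and strict; the monotonicity test excludes the isochronous (constant) case, where
  every energy would be a local extremum.\<close>

definition critical_energies :: "real poly \<Rightarrow> real set" where
  "critical_energies g =
     (let I = energies g; T = period_function g in
      if monotone_on I (\<le>) (\<le>) T \<or> monotone_on I (\<le>) (\<ge>) T then {}
      else {h \<in> I. (\<forall>\<^sub>F s in at h within I. T s \<le> T h) \<or> (\<forall>\<^sub>F s in at h within I. T h \<le> T s)})"

definition num_critical_periods :: "real poly \<Rightarrow> enat" where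
  "num_critical_periods g =
     (if finite (critical_energies g) then enat (card (critical_energies g)) else \<infinity>)"

end

theory Submission
  imports Defs
begin

text \<open>
  A particle in a potential well slows down at an inflection of the potential that is almost
  horizontal. If its turning point sits exactly there, it takes very long to come back, whereas
  orbits of slightly smaller or larger energy have a moderate period. Hence a force
  \<open>g x = x * (\<Prod>i = 1..k. (x - i)\<^sup>2 + e\<^sup>2)\<close> with small \<open>e\<close> produces a high peak of the period function
  at each of the \<open>k\<close> energies \<open>G i\<close>, and the period stays below a bound that does not depend on \<open>e\<close>
  at the \<open>k + 1\<close> energies \<open>G (j + 1/2)\<close> in between (\<open>j \<le> k\<close>). This gives \<open>k\<close> local maxima and \<open>k - 1\<close>
  local minima if \<open>k \<ge> 1\<close>, that is \<open>n - 2\<close> critical periods in degree \<open>n = 2 k + 1\<close>. In degree \<open>n = 2 k + 2\<close> the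
  force has the additional factor \<open>k + 1 - x\<close>. It creates a saddle, the annulus ends at the
  homoclinic loop of that saddle, and the period tends to infinity there, which adds one more
  local minimum after the last peak.

  To make this rigorous, the potential is normalised. With \<open>\<psi> x = sgn x * sqrt (2 * G x)\<close>, which is a
  diffeomorphism near the center because the quotient \<open>2 * G x / x\<^sup>2\<close> is a positive polynomial, and
  \<open>\<phi> = \<psi>\<inverse>\<close>, the orbit of energy \<open>r\<^sup>2 / 2\<close> is the curve \<open>(\<phi> (r * sin \<theta>), r * cos \<theta>)\<close>, along which time
  satisfies \<open>dt = \<phi>' (r * sin \<theta>) d\<theta>\<close>. This yields the periodic solutions explicitly
  (\<open>explicit_solution\<close>), and the period as an integral of a continuous function over a fixed interval,
  which therefore depends continuously on \<open>r\<close> (\<open>T_continuous\<close>). Uniqueness of solutions and the absence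
  of periodic orbits on the boundary of the well identify the period annulus
  (\<open>period_annulus_eq\<close>). The peaks and valleys follow from two comparison estimates for the period
  (\<open>period_lower_bound\<close>, \<open>period_upper_bound\<close>), and a continuous function that is alternately at most
  \<open>B\<close> and greater than \<open>B\<close> at \<open>L + 1\<close> consecutive points has \<open>L - 1\<close> local extrema
  (\<open>oscillation_gives_local_extrema\<close>).
\<close>

section \<open>Solutions and periodic orbits of potential systems\<close>

lemma is_solution_potential_iff:
  "is_solution (potential_field g) u \<longleftrightarrow>
     (\<forall>t. ((\<lambda>t. fst (u t)) has_real_derivative snd (u t)) (at t) \<and>
          ((\<lambda>t. snd (u t)) has_real_derivative - poly g (fst (u t))) (at t))"
proof -
  have "(u has_vector_derivative potential_field g (u t)) (at t) \<longleftrightarrow>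
     ((\<lambda>t. fst (u t)) has_real_derivative snd (u t)) (at t) \<and>
          ((\<lambda>t. snd (u t)) has_real_derivative - poly g (fst (u t))) (at t)" for t
  proof
    assume *: "(u has_vector_derivative potential_field g (u t)) (at t)"
    show "((\<lambda>t. fst (u t)) has_real_derivative snd (u t)) (at t) \<and>
          ((\<lambda>t. snd (u t)) has_real_derivative - poly g (fst (u t))) (at t)"
      using bounded_linear.has_vector_derivative[OF bounded_linear_fst *]
        bounded_linear.has_vector_derivative[OF bounded_linear_snd *]
      by (simp add: has_real_derivative_iff_has_vector_derivative potential_field_def split_beta)
  next
    assume *: "((\<lambda>t. fst (u t)) has_real_derivative snd (u t)) (at t) \<and>
          ((\<lambda>t. snd (u t)) has_real_derivative - poly g (fst (u t))) (at t)"
    have "((\<lambda>t. (fst (u t), snd (u t))) has_vector_derivative (snd (u t), - poly g (fst (u t)))) (at t)"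
      using * by (intro has_vector_derivative_Pair) (auto simp: has_real_derivative_iff_has_vector_derivative)
    then show "(u has_vector_derivative potential_field g (u t)) (at t)"
      by (simp add: potential_field_def split_beta)
  qed
  then show ?thesis
    by (auto simp: is_solution_def)
qed

lemma is_solution_shift:
  "is_solution F u \<Longrightarrow> is_solution F (\<lambda>t. u (t + s))"
  unfolding is_solution_def
proof
  fix t assume *: "\<forall>t. (u has_vector_derivative F (u t)) (at t)"
  have "((\<lambda>t. t + s) has_vector_derivative 1) (at t)"
    by (auto intro!: derivative_eq_intros)
  from vector_diff_chain_at[OF this *[rule_format]]
  show "((\<lambda>t. u (t + s)) has_vector_derivative F (u (t + s))) (at t)"
    by (simp add: o_def)
qed

lemma is_solution_continuous:
  "is_solution F u \<Longrightarrow> continuous_on S u"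
  unfolding is_solution_def
  by (meson continuous_at_imp_continuous_on has_vector_derivative_continuous)

lemma periodic_int:
  fixes u :: "real \<Rightarrow> 'a"
  assumes "\<And>t. u (t + \<tau>) = u t"
  shows "u (t + of_int n * \<tau>) = u t"
proof (induction n)
  case (nonneg n)
  show ?case
  proof (induction n)
    case (Suc n)
    have "u (t + of_int (int (Suc n)) * \<tau>) = u ((t + of_int (int n) * \<tau>) + \<tau>)"
      by (simp add: algebra_simps)
    then show ?case using assms Suc by simp
  qed simp
next
  case (neg n)
  show ?case
  proof (induction n)
    case 0
    show ?case using assms[of "t - \<tau>"] by simp
  next
    case (Suc n)
    have "u ((t + of_int (- int (Suc (Suc n))) * \<tau>) + \<tau>) = u (t + of_int (- int (Suc n)) * \<tau>)"
      by (simp add: algebra_simps)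
    then show ?case using assms Suc by simp
  qed
qed

lemma range_minimal_period:
  assumes "minimal_period u \<tau>"
  shows "range u = u ` {0..\<tau>}"
proof -
  have pos: "0 < \<tau>" and per: "\<And>t. u (t + \<tau>) = u t"
    using assms by (auto simp: minimal_period_def)
  have "u t \<in> u ` {0..\<tau>}" for t
  proof
    let ?n = "\<lfloor>t / \<tau>\<rfloor>"
    show "u t = u (t + of_int (- ?n) * \<tau>)"
      using periodic_int[of u \<tau>, OF per] by metis
    have "of_int ?n * \<tau> \<le> t" "t < (of_int ?n + 1) * \<tau>"
      using floor_correct[of "t / \<tau>"]
      by (simp_all add: pos_divide_less_eq[OF pos, symmetric] pos_le_divide_eq[OF pos, symmetric])
    then show "t + of_int (- ?n) * \<tau> \<in> {0..\<tau>}"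
      by (simp add: algebra_simps)
  qed
  then show ?thesis by auto
qed

lemma compact_periodic_range:
  assumes "is_solution F u" "minimal_period u \<tau>"
  shows "compact (range u)"
  unfolding range_minimal_period[OF assms(2)]
  by (intro compact_continuous_image is_solution_continuous[OF assms(1)]) simp

lemma minimal_period_shift:
  assumes "minimal_period u \<tau>"
  shows "minimal_period (\<lambda>t. u (t + s)) \<tau>"
proof -
  have "\<forall>t. u (t + a) = u t" if "\<forall>t. u (t + a + s) = u (t + s)" for a
  proof
    fix t show "u (t + a) = u t" using that[rule_format, of "t - s"] by (simp add: algebra_simps)
  qed
  moreover have "u (t + \<tau> + s) = u (t + s)" for t
    using assms by (auto simp: minimal_period_def add.commute add.left_commute dest: spec[of _ "t + s"])
  ultimately show ?thesis
    using assms unfolding minimal_period_def by blast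
qed

lemma minimal_period_unique:
  assumes "minimal_period u a" "minimal_period u b"
  shows "a = b"
  using assms unfolding minimal_period_def by (metis linorder_neqE_linordered_idom)

text \<open>Gronwall's argument: the bound makes \<open>E t * exp (- L * t)\<close> nonincreasing and
  \<open>E t * exp (L * t)\<close> nondecreasing, so a nonnegative \<open>E\<close> that vanishes once vanishes always.\<close>

lemma zero_of_differential_inequality:
  fixes E E' :: "real \<Rightarrow> real"
  assumes der: "\<And>t. (E has_real_derivative E' t) (at t)"
    and bound: "\<And>t. \<bar>E' t\<bar> \<le> L * E t"
    and nonneg: "\<And>t. 0 \<le> E t" and zero: "E s = 0"
  shows "E t = 0"
proof (cases "s \<le> t")
  case True
  have "E t * exp (- L * t) \<le> E s * exp (- L * s)"
  proof (rule DERIV_nonpos_imp_nonincreasing[OF True])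
    fix x
    have "((\<lambda>t. E t * exp (- L * t)) has_real_derivative
        (E' x - L * E x) * exp (- L * x)) (at x)"
      by (rule derivative_eq_intros der refl)+ (simp add: algebra_simps)
    moreover have "(E' x - L * E x) * exp (- L * x) \<le> 0"
      using bound[of x] by (intro mult_nonpos_nonneg) auto
    ultimately show "\<exists>y. ((\<lambda>t. E t * exp (- L * t)) has_real_derivative y) (at x) \<and> y \<le> 0"
      by blast
  qed
  then have "E t * exp (- L * t) \<le> 0" by (simp add: zero)
  then show ?thesis using nonneg[of t] by (simp add: mult_le_0_iff)
next
  case False
  then have "t \<le> s" by simp
  then have "E t * exp (L * t) \<le> E s * exp (L * s)"
  proof (rule DERIV_nonneg_imp_nondecreasing)
    fix x
    have "((\<lambda>t. E t * exp (L * t)) has_real_derivative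
        (E' x + L * E x) * exp (L * x)) (at x)"
      by (rule derivative_eq_intros der refl)+ (simp add: algebra_simps)
    moreover have "(E' x + L * E x) * exp (L * x) \<ge> 0"
      using bound[of x] by (intro mult_nonneg_nonneg) auto
    ultimately show "\<exists>y. ((\<lambda>t. E t * exp (L * t)) has_real_derivative y) (at x) \<and> 0 \<le> y"
      by blast
  qed
  then have "E t * exp (L * t) \<le> 0" by (simp add: zero)
  then show ?thesis using nonneg[of t] by (simp add: mult_le_0_iff)
qed

lemma poly_lipschitz_on_interval:
  fixes g :: "real poly"
  shows "\<exists>L\<ge>0. \<forall>x y. \<bar>x\<bar> \<le> R \<longrightarrow> \<bar>y\<bar> \<le> R \<longrightarrow> \<bar>poly g x - poly g y\<bar> \<le> L * \<bar>x - y\<bar>"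
proof -
  have "compact (poly (pderiv g) ` {-R..R})"
    by (intro compact_continuous_image continuous_intros) simp
  then obtain B where B: "\<And>x. x \<in> {-R..R} \<Longrightarrow> \<bar>poly (pderiv g) x\<bar> \<le> B"
    by (force dest!: compact_imp_bounded simp: bounded_iff)
  define L where "L = max 0 B"
  have "\<bar>poly g x - poly g y\<bar> \<le> L * \<bar>x - y\<bar>" if "\<bar>x\<bar> \<le> R" "\<bar>y\<bar> \<le> R" for x y
  proof -
    have "norm (poly g x - poly g y) \<le> L * norm (x - y)"
    proof (rule field_differentiable_bound[where S = "{-R..R}"])
      show "(poly g has_field_derivative poly (pderiv g) z) (at z within {-R..R})" for z
        using poly_DERIV[of g z] by (rule has_field_derivative_at_within)
      show "norm (poly (pderiv g) z) \<le> L" if "z \<in> {-R..R}" for z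
        using B[OF that] by (simp add: L_def)
    qed (use that in auto)
    then show ?thesis by simp
  qed
  then show ?thesis by (intro exI[of _ L]) (simp add: L_def)
qed

text \<open>Boundedness keeps both solutions in a strip on which the polynomial force is Lipschitz;
  there the squared distance of the solutions satisfies the differential inequality above.\<close>

lemma potential_solution_unique:
  assumes u: "is_solution (potential_field g) u" and v: "is_solution (potential_field g) v"
    and bu: "bounded (range u)" and bv: "bounded (range v)"
    and eq: "u s = v s"
  shows "u = v"
proof
  fix t
  obtain A B where AB: "\<And>t. norm (u t) \<le> A" "\<And>t. norm (v t) \<le> B"
    using bu bv by (auto simp: bounded_iff)
  define R where "R = max A B"
  have R: "\<bar>fst (u t)\<bar> \<le> R" "\<bar>fst (v t)\<bar> \<le> R" for t
    using norm_fst_le[of "fst (u t)" "snd (u t)"] norm_fst_le[of "fst (v t)" "snd (v t)"] AB[of t]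
    by (auto simp: R_def)
  obtain L where L: "0 \<le> L" "\<And>x y. \<bar>x\<bar> \<le> R \<Longrightarrow> \<bar>y\<bar> \<le> R \<Longrightarrow> \<bar>poly g x - poly g y\<bar> \<le> L * \<bar>x - y\<bar>"
    using poly_lipschitz_on_interval[of R g] by blast
  define a where "a t = fst (u t) - fst (v t)" for t
  define b where "b t = snd (u t) - snd (v t)" for t
  define d where "d t = poly g (fst (u t)) - poly g (fst (v t))" for t
  define E where "E t = (a t)\<^sup>2 + (b t)\<^sup>2" for t
  have der: "(E has_real_derivative 2 * a t * b t - 2 * b t * d t) (at t)" for t
    unfolding E_def a_def b_def d_def
    by (rule derivative_eq_intros u[unfolded is_solution_potential_iff, rule_format, THEN conjunct1]
        v[unfolded is_solution_potential_iff, rule_format, THEN conjunct1]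
        u[unfolded is_solution_potential_iff, rule_format, THEN conjunct2]
        v[unfolded is_solution_potential_iff, rule_format, THEN conjunct2] refl)+
       (simp add: algebra_simps)
  have "\<bar>2 * a t * b t - 2 * b t * d t\<bar> \<le> (1 + L) * E t" for t
  proof -
    have d: "\<bar>d t\<bar> \<le> L * \<bar>a t\<bar>"
      unfolding d_def a_def using L(2) R by blast
    have "\<bar>2 * a t * b t - 2 * b t * d t\<bar> \<le> \<bar>2 * a t * b t\<bar> + \<bar>2 * b t * d t\<bar>"
      by (rule abs_triangle_ineq4)
    also have "\<dots> = 2 * (\<bar>a t\<bar> * \<bar>b t\<bar>) + 2 * (\<bar>b t\<bar> * \<bar>d t\<bar>)"
      by (simp add: abs_mult)
    also have "\<dots> \<le> 2 * (\<bar>a t\<bar> * \<bar>b t\<bar>) + 2 * (\<bar>b t\<bar> * (L * \<bar>a t\<bar>))"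
      using d by (intro add_left_mono mult_left_mono) auto
    also have "\<dots> = (1 + L) * (2 * \<bar>a t\<bar> * \<bar>b t\<bar>)"
      by (simp add: algebra_simps)
    also have "\<dots> \<le> (1 + L) * E t"
      using sum_squares_bound[of "\<bar>a t\<bar>" "\<bar>b t\<bar>"] L(1)
      by (intro mult_left_mono) (auto simp: E_def)
    finally show ?thesis .
  qed
  then have "E t = 0"
    by (rule zero_of_differential_inequality[OF der, where s = s]) (simp_all add: E_def a_def b_def eq)
  then show "u t = v t"
    by (simp add: E_def a_def b_def prod_eq_iff sum_power2_eq_zero_iff)
qed

text \<open>Since the system is autonomous, two solutions that meet at all, even at different times, are
  time shifts of each other. This is what makes a periodic orbit and its period well defined.\<close>

lemma periodic_solution_through_point:
  assumes u: "is_solution (potential_field g) u" "bounded (range u)"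
    and v: "is_solution (potential_field g) v" "bounded (range v)"
    and eq: "u a = v b"
  shows "v = (\<lambda>t. u (t + (a - b)))"
proof (rule potential_solution_unique[where s = b])
  show "bounded (range (\<lambda>t. u (t + (a - b))))"
    by (rule bounded_subset[OF u(2)]) auto
qed (use assms in \<open>auto intro: is_solution_shift\<close>)

lemma no_periodic_orbit_through_equilibrium:
  assumes "poly g c = 0" "periodic_orbit (potential_field g) \<gamma>"
  shows "(c, 0) \<notin> \<gamma>"
proof
  assume "(c, 0) \<in> \<gamma>"
  then obtain u \<tau> s where u: "is_solution (potential_field g) u" "minimal_period u \<tau>"
      and s: "u s = (c, 0)"
    using assms(2) by (force simp: periodic_orbit_def)
  have "u = (\<lambda>t. (c, 0))"
  proof (rule potential_solution_unique[OF u(1)])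
    show "is_solution (potential_field g) (\<lambda>t. (c, 0))"
      using assms(1) by (simp add: is_solution_potential_iff)
  qed (use s compact_imp_bounded[OF compact_periodic_range[OF u]] in \<open>auto intro: finite_imp_bounded\<close>)
  then show False
    using u(2) by (auto simp: minimal_period_def dest!: spec[of _ "\<tau> / 2"])
qed

section \<open>Potential wells and their period function\<close>

definition potential :: "real poly \<Rightarrow> real \<Rightarrow> real" where
  "potential p x = (\<Sum>i\<le>degree p. coeff p i * x ^ (i + 2) / real (i + 2))"

text \<open>The polynomial \<open>2 * potential p x / x\<^sup>2\<close>. Being positive on a well, it has a differentiable
  square root, also at the center, where \<open>sqrt (2 * potential p x)\<close> itself has a corner.\<close>

definition potential_quotient :: "real poly \<Rightarrow> real poly" where
  "potential_quotient p = (\<Sum>i\<le>degree p. monom (2 * coeff p i / real (i + 2)) i)"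

lemma hamiltonian_eq_potential:
  "hamiltonian (pCons 0 p) (x, y) = y\<^sup>2 / 2 + potential p x"
proof (cases "p = 0")
  case False
  then show ?thesis
    by (simp add: hamiltonian_def potential_def sum.atMost_Suc_shift add_ac del: sum.atMost_Suc)
qed (simp add: hamiltonian_def potential_def)

lemma potential_eq: "potential p x = x\<^sup>2 * poly (potential_quotient p) x / 2"
  unfolding potential_def potential_quotient_def poly_sum poly_monom sum_distrib_left sum_divide_distrib
  by (intro sum.cong refl) (simp add: power2_eq_square divide_simps)

lemma potential_0 [simp]: "potential p 0 = 0"
  by (simp add: potential_eq)

lemma potential_quotient_0: "poly (potential_quotient p) 0 = poly p 0"
  by (simp add: potential_quotient_def poly_0_coeff_0 coeff_sum)

lemma potential_DERIV: "(potential p has_real_derivative x * poly p x) (at x)"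
proof -
  have "((\<lambda>x. coeff p i * x ^ (i + 2) / real (i + 2)) has_real_derivative x * (coeff p i * x ^ i)) (at x)" for i
    by (rule DERIV_cong[OF DERIV_cdivide[OF DERIV_cmult[OF DERIV_pow]]]) (simp add: field_simps)
  then have "(potential p has_real_derivative (\<Sum>i\<le>degree p. x * (coeff p i * x ^ i))) (at x)"
    unfolding potential_def by (intro DERIV_sum)
  then show ?thesis
    by (simp add: poly_altdef sum_distrib_left)
qed

lemma potential_continuous [continuous_intros]: "continuous_on S (potential p)"
  using potential_DERIV DERIV_isCont continuous_at_imp_continuous_on by blast

text \<open>The force is \<open>x * poly p x\<close>, so positivity of \<open>p\<close> says that it points to the center. The last
  assumption makes the two ends of the well equally high: every energy reached on one side of the
  center is also reached on the other, so that each level set in the well closes up to an oval.\<close>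

locale potential_well =
  fixes p :: "real poly" and X :: "real set"
  assumes open_X: "open X" and connected_X: "connected X" and zero_in_X: "0 \<in> X"
    and p_pos: "x \<in> X \<Longrightarrow> 0 < poly p x"
    and opposite: "x \<in> X \<Longrightarrow> \<exists>z\<in>X. x * z \<le> 0 \<and> potential p z = potential p x"
begin

abbreviation F :: "real \<times> real \<Rightarrow> real \<times> real" where
  "F \<equiv> potential_field (pCons 0 p)"

abbreviation K :: "real \<Rightarrow> real" where
  "K \<equiv> poly (potential_quotient p)"

text \<open>The normalising coordinate: \<open>\<psi> x\<close> has the sign of \<open>x\<close> and \<open>(\<psi> x)\<^sup>2 / 2\<close> is the potential, so that
  energy levels are circles in the plane with coordinates \<open>(\<psi> x, y)\<close>.\<close>

definition \<psi> :: "real \<Rightarrow> real" where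
  "\<psi> x = x * sqrt (K x)"

definition d\<psi> :: "real \<Rightarrow> real" where
  "d\<psi> x = sqrt (K x) + x * (poly (pderiv (potential_quotient p)) x / (2 * sqrt (K x)))"

definition J :: "real set" where "J = \<psi> ` X"

definition \<phi> :: "real \<Rightarrow> real" where "\<phi> = the_inv_into X \<psi>"

definition d\<phi> :: "real \<Rightarrow> real" where "d\<phi> s = inverse (d\<psi> (\<phi> s))"

lemma between_in_X: "a \<in> X \<Longrightarrow> b \<in> X \<Longrightarrow> a \<le> x \<Longrightarrow> x \<le> b \<Longrightarrow> x \<in> X"
  using connected_X connected_contains_Icc by (meson atLeastAtMost_iff subsetD)

lemma potential_pos: assumes "x \<in> X" "x \<noteq> 0" shows "0 < potential p x"
proof (cases "0 < x")
  case True
  have "potential p 0 < potential p x"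
  proof (rule DERIV_pos_imp_increasing_open[OF True])
    fix y assume "0 < y" "y < x"
    then show "\<exists>d. (potential p has_real_derivative d) (at y) \<and> 0 < d"
      using between_in_X[OF zero_in_X assms(1)] p_pos
      by (intro exI[of _ "y * poly p y"] conjI potential_DERIV) simp
  qed (intro continuous_intros)
  then show ?thesis by simp
next
  case False
  then have "x < 0" using assms by simp
  then have "potential p x > potential p 0"
  proof (rule DERIV_neg_imp_decreasing_open)
    fix y assume "x < y" "y < 0"
    then show "\<exists>d. (potential p has_real_derivative d) (at y) \<and> d < 0"
      using between_in_X[OF assms(1) zero_in_X] p_pos
      by (intro exI[of _ "y * poly p y"] conjI potential_DERIV) (simp add: mult_neg_pos)
  qed (intro continuous_intros)
  then show ?thesis by simp
qed

lemma K_pos: "x \<in> X \<Longrightarrow> 0 < K x"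
  using potential_pos[of x] p_pos[OF zero_in_X]
  by (cases "x = 0") (auto simp: potential_eq potential_quotient_0 zero_less_mult_iff)

lemma \<psi>_square: "x \<in> X \<Longrightarrow> (\<psi> x)\<^sup>2 = 2 * potential p x"
  using K_pos[of x] by (simp add: \<psi>_def potential_eq power_mult_distrib)

lemma \<psi>_0 [simp]: "\<psi> 0 = 0"
  by (simp add: \<psi>_def)

lemma \<psi>_DERIV: "x \<in> X \<Longrightarrow> (\<psi> has_real_derivative d\<psi> x) (at x)"
  unfolding \<psi>_def d\<psi>_def using K_pos[of x]
  by (auto intro!: derivative_eq_intros simp: field_simps)

lemma \<psi>_continuous: "continuous_on X \<psi>"
  by (meson DERIV_isCont \<psi>_DERIV continuous_at_imp_continuous_on)

lemma \<psi>_pos_iff: "x \<in> X \<Longrightarrow> 0 < \<psi> x \<longleftrightarrow> 0 < x"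
  and \<psi>_neg_iff: "x \<in> X \<Longrightarrow> \<psi> x < 0 \<longleftrightarrow> x < 0"
  using K_pos[of x] by (auto simp: \<psi>_def zero_less_mult_iff mult_less_0_iff)

text \<open>Both sides are the derivative of \<open>(\<psi> x)\<^sup>2 / 2 = potential p x\<close>.\<close>

lemma \<psi>_times_d\<psi>: assumes "x \<in> X" shows "\<psi> x * d\<psi> x = x * poly p x"
proof -
  have "((\<lambda>x. (\<psi> x)\<^sup>2 / 2) has_real_derivative \<psi> x * d\<psi> x) (at x)"
    using \<psi>_DERIV[OF assms] by (auto intro!: derivative_eq_intros)
  moreover have "((\<lambda>x. (\<psi> x)\<^sup>2 / 2) has_real_derivative x * poly p x) (at x)"
    by (rule has_field_derivative_transform_within_open[OF potential_DERIV open_X assms])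
       (simp add: \<psi>_square)
  ultimately show ?thesis by (rule DERIV_unique)
qed

lemma d\<psi>_pos: assumes "x \<in> X" shows "0 < d\<psi> x"
proof (cases "x = 0")
  case True
  then show ?thesis using K_pos[OF assms] by (simp add: d\<psi>_def)
next
  case False
  have "0 < \<psi> x * \<psi> x * d\<psi> x / (\<psi> x * \<psi> x)"
    using \<psi>_times_d\<psi>[OF assms] p_pos[OF assms] K_pos[OF assms] False
    by (simp add: mult.assoc) (simp add: \<psi>_def zero_less_mult_iff mult.assoc)
  then show ?thesis by (simp split: if_splits)
qed

lemma \<psi>_strict_mono: assumes "x \<in> X" "y \<in> X" "x < y" shows "\<psi> x < \<psi> y"
  using assms(3)
proof (rule DERIV_pos_imp_increasing)
  fix z assume "x \<le> z" "z \<le> y"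
  then have "z \<in> X" using between_in_X assms by blast
  then show "\<exists>d. (\<psi> has_real_derivative d) (at z) \<and> 0 < d"
    using \<psi>_DERIV d\<psi>_pos by blast
qed

lemma \<psi>_inj: "inj_on \<psi> X"
  by (intro inj_onI) (metis \<psi>_strict_mono less_irrefl linorder_neqE_linordered_idom)

lemma \<psi>_in_J: "x \<in> X \<Longrightarrow> \<psi> x \<in> J"
  by (simp add: J_def)

lemma \<phi>_\<psi> [simp]: "x \<in> X \<Longrightarrow> \<phi> (\<psi> x) = x"
  by (simp add: \<phi>_def the_inv_into_f_f \<psi>_inj)

lemma \<psi>_\<phi> [simp]: "s \<in> J \<Longrightarrow> \<psi> (\<phi> s) = s"
  and \<phi>_in_X: "s \<in> J \<Longrightarrow> \<phi> s \<in> X"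
  by (auto simp: J_def)

lemma open_J: "open J"
  unfolding J_def by (rule invariance_of_domain[OF \<psi>_continuous open_X \<psi>_inj])

lemma zero_in_J: "0 \<in> J"
  using \<psi>_in_J[OF zero_in_X] by simp

lemma between_in_J: "a \<in> J \<Longrightarrow> b \<in> J \<Longrightarrow> a \<le> s \<Longrightarrow> s \<le> b \<Longrightarrow> s \<in> J"
  using connected_continuous_image[OF \<psi>_continuous connected_X] connected_contains_Icc
  unfolding J_def by (meson atLeastAtMost_iff subsetD)

text \<open>The levels in \<open>J\<close> are symmetric because of the assumption that the two sides of the well are
  equally high; hence \<open>J\<close> contains \<open>r * sin u\<close> for all \<open>u\<close> as soon as it contains \<open>r\<close>.\<close>

lemma minus_in_J: assumes "s \<in> J" shows "- s \<in> J"
proof -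
  obtain x where x: "x \<in> X" "s = \<psi> x" using assms by (auto simp: J_def)
  obtain z where z: "z \<in> X" "x * z \<le> 0" "potential p z = potential p x"
    using opposite[OF x(1)] by blast
  have "(\<psi> z)\<^sup>2 = (\<psi> x)\<^sup>2" using x z by (simp add: \<psi>_square)
  moreover have "\<psi> z * \<psi> x \<le> 0"
  proof -
    have "\<not> (0 < x \<and> 0 < z)" "\<not> (x < 0 \<and> z < 0)"
      using z(2) by (auto simp: mult_le_0_iff)
    then show ?thesis
      unfolding mult_le_0_iff
      using \<psi>_pos_iff[OF x(1)] \<psi>_neg_iff[OF x(1)] \<psi>_pos_iff[OF z(1)] \<psi>_neg_iff[OF z(1)]
      by (smt (verit))
  qed
  ultimately have "\<psi> z = - \<psi> x"
    by (auto simp: power2_eq_iff mult_le_0_iff)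
  then show ?thesis using x z \<psi>_in_J by metis
qed

lemma abs_le_in_J: assumes "r \<in> J" "\<bar>s\<bar> \<le> \<bar>r\<bar>" shows "s \<in> J"
  using between_in_J[of "- \<bar>r\<bar>" "\<bar>r\<bar>" s] minus_in_J[OF assms(1)] assms
  by (cases "r \<ge> 0") auto

lemma sin_in_J: "r \<in> J \<Longrightarrow> r * sin u \<in> J"
  by (rule abs_le_in_J[of r]) (auto simp: abs_mult intro: mult_left_le)

lemma \<phi>_continuous: "continuous_on J \<phi>"
  unfolding J_def by (rule continuous_on_inverse_open[OF open_X \<psi>_continuous]) auto

lemma \<phi>_DERIV: assumes "s \<in> J" shows "(\<phi> has_real_derivative d\<phi> s) (at s)"
proof -
  obtain e where e: "0 < e" "ball s e \<subseteq> J"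
    using open_J assms open_contains_ball by blast
  show ?thesis
    unfolding d\<phi>_def
  proof (rule DERIV_inverse_function[where a = "s - e" and b = "s + e" and f = \<psi>])
    show "(\<psi> has_real_derivative d\<psi> (\<phi> s)) (at (\<phi> s))"
      using \<psi>_DERIV \<phi>_in_X assms by blast
    show "d\<psi> (\<phi> s) \<noteq> 0" using d\<psi>_pos \<phi>_in_X assms by (metis less_irrefl)
    show "\<psi> (\<phi> y) = y" if "s - e < y" "y < s + e" for y
      using that e(2) by (intro \<psi>_\<phi>) (auto simp: dist_real_def subset_iff)
    show "isCont \<phi> s"
      using \<phi>_continuous open_J assms by (simp add: continuous_on_eq_continuous_at)
  qed (use e in auto)
qed

lemma d\<phi>_pos: "s \<in> J \<Longrightarrow> 0 < d\<phi> s"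
  using d\<psi>_pos \<phi>_in_X by (simp add: d\<phi>_def)

lemma d\<psi>_continuous: "continuous_on X d\<psi>"
  unfolding d\<psi>_def using K_pos by (intro continuous_intros) (metis less_irrefl real_sqrt_eq_zero_cancel_iff mult_eq_0_iff zero_neq_numeral)

lemma d\<phi>_continuous: "continuous_on J d\<phi>"
  unfolding d\<phi>_def
proof (intro continuous_intros)
  show "continuous_on J (\<lambda>s. d\<psi> (\<phi> s))"
    by (rule continuous_on_compose2[OF d\<psi>_continuous \<phi>_continuous]) (use \<phi>_in_X in auto)
qed (use d\<psi>_pos \<phi>_in_X less_irrefl in metis)

lemma d\<phi>_times_force: "s \<in> J \<Longrightarrow> d\<phi> s * (\<phi> s * poly p (\<phi> s)) = s"
  using \<psi>_times_d\<psi>[OF \<phi>_in_X, of s] d\<psi>_pos[OF \<phi>_in_X, of s]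
  by (simp add: d\<phi>_def field_simps)

text \<open>The period of the orbit of energy \<open>r\<^sup>2 / 2\<close>: the angle \<open>u\<close> runs from the left turning point
  at \<open>- pi / 2\<close> to the right one at \<open>pi / 2\<close>, and the way back takes equally long.\<close>

definition T :: "real \<Rightarrow> real" where
  "T r = 2 * integral {- pi / 2..pi / 2} (\<lambda>u. d\<phi> (r * sin u))"

text \<open>\<open>P u\<close> is the time at which the orbit passes the point of angle \<open>u\<close>. An antiderivative on the
  whole line, rather than an integral from \<open>0\<close>, avoids a case distinction on the sign of \<open>u\<close>.\<close>

definition clock :: "real \<Rightarrow> (real \<Rightarrow> real) \<Rightarrow> bool" where
  "clock r P \<longleftrightarrow> (\<forall>u. (P has_real_derivative d\<phi> (r * sin u)) (at u))"

lemma clock_exists: assumes "r \<in> J" obtains P where "clock r P"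
proof -
  have "isCont (\<lambda>u. d\<phi> (r * sin u)) x" for x
  proof -
    have "continuous_on UNIV (\<lambda>u. d\<phi> (r * sin u))"
      by (rule continuous_on_compose2[OF d\<phi>_continuous]) (auto intro!: continuous_intros sin_in_J assms)
    then show ?thesis by (simp add: continuous_on_eq_continuous_at)
  qed
  then obtain P where "\<And>x. (P has_vector_derivative d\<phi> (r * sin x)) (at x)"
    using einterval_antiderivative[of "-\<infinity>" "\<infinity>" "\<lambda>u. d\<phi> (r * sin u)"] by auto
  then show thesis
    using that[of P] by (simp add: clock_def has_real_derivative_iff_has_vector_derivative)
qed

lemma clock_T: assumes "clock r P" shows "T r = 2 * (P (pi / 2) - P (- pi / 2))"
proof -
  have "((\<lambda>u. d\<phi> (r * sin u)) has_integral (P (pi / 2) - P (- pi / 2))) {- pi / 2..pi / 2}"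
    by (rule fundamental_theorem_of_calculus)
       (use assms in \<open>auto simp: clock_def has_real_derivative_iff_has_vector_derivative
          intro: has_vector_derivative_at_within\<close>)
  then show ?thesis by (simp add: T_def integral_unique)
qed

text \<open>One full turn adds the same amount of time everywhere. To see that it is \<open>T r\<close>, use the symmetry
  \<open>sin (pi - u) = sin u\<close>: the function \<open>P (pi - u) + P u\<close> is constant.\<close>

lemma clock_period: assumes "clock r P" shows "P (u + 2 * pi) = P u + T r"
proof -
  have 1: "((\<lambda>u. P (u + 2 * pi) - P u) has_real_derivative 0) (at u)" for u
  proof -
    have "((\<lambda>u. P (u + 2 * pi)) has_real_derivative d\<phi> (r * sin (u + 2 * pi)) * 1) (at u)"
      by (rule DERIV_chain2[where f = P, OF assms[unfolded clock_def, rule_format]])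
         (auto intro!: derivative_eq_intros)
    from DERIV_diff[OF this assms[unfolded clock_def, rule_format, of u]]
    show ?thesis by simp
  qed
  have 2: "((\<lambda>u. P (pi - u) + P u) has_real_derivative 0) (at u)" for u
  proof -
    have "((\<lambda>u. P (pi - u)) has_real_derivative d\<phi> (r * sin (pi - u)) * (- 1)) (at u)"
      by (rule DERIV_chain2[where f = P, OF assms[unfolded clock_def, rule_format]])
         (auto intro!: derivative_eq_intros)
    from DERIV_add[OF this assms[unfolded clock_def, rule_format, of u]]
    show ?thesis by simp
  qed
  have "P (u + 2 * pi) - P u = P (- pi / 2 + 2 * pi) - P (- pi / 2)"
    using DERIV_isconst_all[of "\<lambda>u. P (u + 2 * pi) - P u" u "- pi / 2"] 1 by blast
  moreover have "P (pi - - pi / 2) + P (- pi / 2) = P (pi - pi / 2) + P (pi / 2)"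
    using DERIV_isconst_all[of "\<lambda>u. P (pi - u) + P u" "- pi / 2" "pi / 2"] 2 by blast
  ultimately show ?thesis
    unfolding clock_T[OF assms] by (simp add: field_simps)
qed

lemma clock_strict_mono: assumes "clock r P" "r \<in> J" "a < b" shows "P a < P b"
  using assms(3)
proof (rule DERIV_pos_imp_increasing)
  fix x
  show "\<exists>y. (P has_real_derivative y) (at x) \<and> 0 < y"
    using assms d\<phi>_pos[OF sin_in_J[OF assms(2)]] by (auto simp: clock_def)
qed

lemma T_pos: assumes "r \<in> J" shows "0 < T r"
proof -
  obtain P where P: "clock r P" using clock_exists[OF assms] .
  show ?thesis
    using clock_strict_mono[OF P assms, of "- pi / 2" "pi / 2"] clock_T[OF P] by simp
qed

lemma T_continuous: "continuous_on J T"
proof -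
  have "continuous_on (J \<times> cbox (- pi / 2) (pi / 2)) (\<lambda>(r, u). d\<phi> (r * sin u))"
    unfolding split_beta
    by (rule continuous_on_compose2[OF d\<phi>_continuous]) (auto intro!: continuous_intros sin_in_J)
  from integral_continuous_on_param[OF this] show ?thesis
    unfolding T_def by (intro continuous_intros) simp
qed

text \<open>Surjectivity comes from the linear growth \<open>P (u + 2 * pi * n) = P u + n * T r\<close>.\<close>

lemma clock_bij: assumes "clock r P" "r \<in> J" shows "bij P"
proof (rule bijI)
  show "inj P"
    by (intro injI) (metis clock_strict_mono[OF assms] less_irrefl linorder_neqE_linordered_idom)
  have T: "0 < T r" using T_pos assms by simp
  have shift: "P (of_int n * (2 * pi)) = P 0 + of_int n * T r" for n
  proof -
    \<comment> \<open>Subtracting the mean growth makes the clock periodic.\<close>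
    define Q where "Q u = P u - u * (T r / (2 * pi))" for u
    have "(u + 2 * pi) * (T r / (2 * pi)) = u * (T r / (2 * pi)) + T r" for u
      by (simp add: field_simps)
    then have "Q (u + 2 * pi) = Q u" for u
      by (simp add: Q_def clock_period[OF assms(1)])
    from periodic_int[of Q, OF this, of 0 n] show ?thesis by (simp add: Q_def field_simps)
  qed
  show "surj P"
    unfolding surj_def
  proof
    fix y
    obtain n :: nat where n: "\<bar>y - P 0\<bar> \<le> real n * T r"
      using reals_Archimedean3[OF T] by (meson less_imp_le)
    have "\<exists>x\<ge>- (real n * (2 * pi)). x \<le> real n * (2 * pi) \<and> P x = y"
    proof (rule IVT')
      show "P (- (real n * (2 * pi))) \<le> y" "y \<le> P (real n * (2 * pi))"
        using n shift[of "- int n"] shift[of "int n"] by auto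
      show "continuous_on {- (real n * (2 * pi))..real n * (2 * pi)} P"
        using assms(1) unfolding clock_def
        by (meson DERIV_isCont continuous_at_imp_continuous_on)
    qed simp
    then show "\<exists>x. y = P x" by blast
  qed
qed

definition level :: "real \<Rightarrow> (real \<times> real) set" where
  "level r = {(x, y). x \<in> X \<and> (\<psi> x)\<^sup>2 + y\<^sup>2 = r\<^sup>2}"

text \<open>The solution runs along the circle of radius \<open>r\<close> in normalised coordinates with the angle \<open>\<Theta> t\<close>
  given by the inverse of the clock. Its period is the time of one turn, and no smaller period is
  possible since the point \<open>(0, r)\<close> belongs to the angle \<open>0\<close> only, modulo \<open>2 * pi\<close>.\<close>

lemma explicit_solution:
  assumes r: "r \<in> J" "0 < r"
  obtains u where "is_solution F u" "minimal_period u (T r)" "range u = level r"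
proof -
  obtain P where P: "clock r P" using clock_exists[OF r(1)] .
  note bij = clock_bij[OF P r(1)]
  define \<Theta> where "\<Theta> = inv P"
  have P\<Theta>: "P (\<Theta> t) = t" and \<Theta>P: "\<Theta> (P t) = t" for t
    using bij by (simp_all add: \<Theta>_def bij_is_surj surj_f_inv_f bij_is_inj)
  have cont: "isCont \<Theta> t" for t
  proof -
    have "continuous_on (P ` UNIV) \<Theta>"
      by (rule continuous_on_inverse_open)
         (use P DERIV_isCont \<Theta>P in \<open>auto simp: clock_def intro!: continuous_at_imp_continuous_on\<close>)
    then show ?thesis
      using bij by (simp add: bij_is_surj continuous_on_eq_continuous_at)
  qed
  have der: "(\<Theta> has_real_derivative inverse (d\<phi> (r * sin (\<Theta> t)))) (at t)" for t
    by (rule DERIV_inverse_function[where f = P and a = "t - 1" and b = "t + 1"])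
       (use P d\<phi>_pos[OF sin_in_J[OF r(1)], of "\<Theta> t"] P\<Theta> cont in \<open>auto simp: clock_def\<close>)
  define u where "u t = (\<phi> (r * sin (\<Theta> t)), r * cos (\<Theta> t))" for t
  have "is_solution F u"
    unfolding is_solution_potential_iff
  proof (intro allI conjI)
    fix t
    let ?s = "r * sin (\<Theta> t)"
    have s: "?s \<in> J" by (rule sin_in_J[OF r(1)])
    have nz: "d\<phi> ?s \<noteq> 0" using d\<phi>_pos[OF s] by simp
    have "((\<lambda>t. r * sin (\<Theta> t)) has_real_derivative r * (cos (\<Theta> t) * inverse (d\<phi> ?s))) (at t)"
      by (rule derivative_eq_intros der refl)+ simp
    from DERIV_cong[OF DERIV_chain2[OF \<phi>_DERIV[OF s] this], of "r * cos (\<Theta> t)"] nz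
    show "((\<lambda>t. fst (u t)) has_real_derivative snd (u t)) (at t)"
      by (simp add: u_def field_simps)
    have "((\<lambda>t. r * cos (\<Theta> t)) has_real_derivative r * (- sin (\<Theta> t) * inverse (d\<phi> ?s))) (at t)"
      by (rule derivative_eq_intros der refl)+ simp
    moreover have "r * (- sin (\<Theta> t) * inverse (d\<phi> ?s)) = - (\<phi> ?s * poly p (\<phi> ?s))"
      using d\<phi>_times_force[OF s] nz by (simp add: field_simps)
    ultimately show "((\<lambda>t. snd (u t)) has_real_derivative - poly (pCons 0 p) (fst (u t))) (at t)"
      by (simp add: u_def)
  qed
  moreover have "minimal_period u (T r)"
    unfolding minimal_period_def
  proof (intro conjI allI impI notI)
    show "0 < T r" using T_pos r by simp
    show "u (t + T r) = u t" for t
    proof -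
      have "\<Theta> (t + T r) = \<Theta> t + 2 * pi"
        using clock_period[OF P, of "\<Theta> t"] P\<Theta> \<Theta>P by metis
      then show ?thesis by (simp add: u_def)
    qed
    fix s assume s: "0 < s \<and> s < T r" and per: "\<forall>t. u (t + s) = u t"
    define \<beta> where "\<beta> = \<Theta> (P 0 + s)"
    have "P \<beta> = P 0 + s" by (simp add: \<beta>_def P\<Theta>)
    then have "P 0 < P \<beta>" "P \<beta> < P (2 * pi)"
      using s clock_period[OF P, of 0] by auto
    then have \<beta>: "0 < \<beta>" "\<beta> < 2 * pi"
      using clock_strict_mono[OF P r(1)] by (metis linorder_neqE_linordered_idom order_less_asym)+
    have "cos \<beta> = 1"
      using per[rule_format, of "P 0"] r(2) by (simp add: u_def \<beta>_def[symmetric] \<Theta>P)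
    then obtain n :: int where "\<beta> = of_int n * 2 * pi"
      by (auto simp: cos_one_2pi_int)
    then have "0 < real_of_int n" "real_of_int n < 1"
      using \<beta> by (auto simp: zero_less_mult_iff)
    then show False by (simp only: of_int_0_less_iff of_int_less_1_iff)
  qed
  moreover have "range u = level r"
  proof
    show "range u \<subseteq> level r"
    proof clarsimp
      fix t
      have "(r * sin (\<Theta> t))\<^sup>2 + (r * cos (\<Theta> t))\<^sup>2 = r\<^sup>2"
        by (simp add: power_mult_distrib flip: distrib_left)
      then show "u t \<in> level r"
        using sin_in_J[OF r(1), of "\<Theta> t"] \<phi>_in_X by (simp add: u_def level_def)
    qed
    show "level r \<subseteq> range u"
    proof clarify
      fix x y assume "(x, y) \<in> level r"
      then have x: "x \<in> X" and eq: "(\<psi> x)\<^sup>2 + y\<^sup>2 = r\<^sup>2" by (auto simp: level_def)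
      have "(y / r)\<^sup>2 + (\<psi> x / r)\<^sup>2 = 1"
        using eq r(2) by (simp add: power_divide add.commute flip: add_divide_distrib)
      from sincos_total_2pi[OF this] obtain \<theta> where \<theta>: "y / r = cos \<theta>" "\<psi> x / r = sin \<theta>" by blast
      then have "u (P \<theta>) = (x, y)"
        using r(2) x by (simp add: u_def \<Theta>P field_simps flip: \<theta>)
      then show "(x, y) \<in> range u" by (metis rangeI)
    qed
  qed
  ultimately show thesis using that by blast
qed

section \<open>The period annulus of a well\<close>

lemma periodic_orbit_eq_level:
  assumes r: "r \<in> J" "0 < r" and \<gamma>: "periodic_orbit F \<gamma>" and q: "q \<in> \<gamma>" "q \<in> level r"
  shows "\<gamma> = level r"
proof -
  obtain u where u: "is_solution F u" "minimal_period u (T r)" "range u = level r"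
    using explicit_solution[OF r] .
  obtain v \<tau> where v: "is_solution F v" "minimal_period v \<tau>" "range v = \<gamma>"
    using \<gamma> by (auto simp: periodic_orbit_def)
  obtain a b where ab: "q = u a" "q = v b"
    using q u(3) v(3) by (metis imageE)
  have "v = (\<lambda>t. u (t + (a - b)))"
    by (rule periodic_solution_through_point)
       (use u(1) v(1) ab compact_imp_bounded[OF compact_periodic_range[OF u(1,2)]]
          compact_imp_bounded[OF compact_periodic_range[OF v(1,2)]] in simp_all)
  moreover have "range (\<lambda>t. u (t + (a - b))) = range u"
    by (auto simp: image_iff) (metis diff_add_cancel)
  ultimately show ?thesis using u(3) v(3) by simp
qed

lemma periodic_orbit_level:
  assumes r: "r \<in> J" "0 < r"
  shows "periodic_orbit F (level r)"
proof -
  obtain u where "is_solution F u" "minimal_period u (T r)" "range u = level r"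
    using explicit_solution[OF r] .
  then show ?thesis unfolding periodic_orbit_def by blast
qed

lemma orbit_period_level:
  assumes r: "r \<in> J" "0 < r"
  shows "orbit_period F (level r) = T r"
proof -
  obtain u where u: "is_solution F u" "minimal_period u (T r)" "range u = level r"
    using explicit_solution[OF r] .
  have unique: "\<tau> = T r" if v: "is_solution F v" "range v = level r" "minimal_period v \<tau>" for v \<tau>
  proof -
    have "v 0 \<in> range u" using u(3) v(2) rangeI[of v 0] by simp
    then obtain a where a: "u a = v 0" by auto
    have "v = (\<lambda>t. u (t + (a - 0)))"
      by (rule periodic_solution_through_point)
         (use u(1) v(1) a compact_imp_bounded[OF compact_periodic_range[OF u(1,2)]]
            compact_imp_bounded[OF compact_periodic_range[OF v(1,3)]] in simp_all)
    then have "minimal_period v (T r)" using minimal_period_shift[OF u(2)] by simp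
    then show ?thesis by (rule minimal_period_unique[OF v(3)])
  qed
  show ?thesis
    unfolding orbit_period_def
  proof (rule the_equality)
    show "\<exists>u. is_solution F u \<and> range u = level r \<and> minimal_period u (T r)"
      using u by blast
    show "\<tau> = T r" if "\<exists>u. is_solution F u \<and> range u = level r \<and> minimal_period u \<tau>" for \<tau>
      using that unique by blast
  qed
qed

text \<open>The part of the plane filled by the ovals: the disc (or plane) of points whose norm lies in \<open>J\<close>,
  seen through the coordinates \<open>(\<psi> x, y)\<close>.\<close>

definition region :: "(real \<times> real) set" where
  "region = {(x, y). x \<in> X \<and> norm (\<psi> x, y) \<in> J}"

lemma region_iff_level:
  "q \<in> region \<and> q \<noteq> 0 \<longleftrightarrow> (\<exists>r\<in>J. 0 < r \<and> q \<in> level r)"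
proof
  assume q: "q \<in> region \<and> q \<noteq> 0"
  obtain x y where xy: "q = (x, y)" by fastforce
  let ?r = "norm (\<psi> x, y)"
  have x: "x \<in> X" "?r \<in> J" using q xy by (auto simp: region_def)
  have "\<psi> x \<noteq> 0 \<or> y \<noteq> 0"
    using q xy \<psi>_pos_iff[OF x(1)] \<psi>_neg_iff[OF x(1)] by (auto simp: zero_prod_def)
  then have "0 < ?r" by (auto simp: norm_Pair sum_power2_gt_zero_iff)
  moreover have "q \<in> level ?r"
    using x by (simp add: xy level_def norm_Pair)
  ultimately show "\<exists>r\<in>J. 0 < r \<and> q \<in> level r" using x by blast
next
  assume "\<exists>r\<in>J. 0 < r \<and> q \<in> level r"
  then obtain r where r: "r \<in> J" "0 < r" "q \<in> level r" by blast
  obtain x y where xy: "q = (x, y)" by fastforce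
  have "norm (\<psi> x, y) = r"
    using r by (simp add: xy level_def norm_Pair)
  then show "q \<in> region \<and> q \<noteq> 0"
    using r by (auto simp: xy level_def region_def zero_prod_def)
qed

lemma zero_in_region: "0 \<in> region"
  using zero_in_X zero_in_J by (simp add: region_def zero_prod_def norm_Pair)

lemma open_region: "open region"
proof -
  have "continuous_on (X \<times> UNIV) (\<lambda>q. norm (\<psi> (fst q), snd q :: real))"
    by (intro continuous_intros continuous_on_compose2[OF \<psi>_continuous]) auto
  then have "open ((X \<times> UNIV) \<inter> (\<lambda>q. norm (\<psi> (fst q), snd q :: real)) -` J)"
    by (intro continuous_open_preimage open_Times open_X open_J) auto
  also have "(X \<times> UNIV) \<inter> (\<lambda>q. norm (\<psi> (fst q), snd q :: real)) -` J = region"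
    by (auto simp: region_def)
  finally show ?thesis .
qed

text \<open>The region is the continuous image of a convex set, the disc in normalised coordinates.\<close>

lemma connected_region: "connected region"
proof -
  let ?B = "{q :: real \<times> real. norm q \<in> J}"
  have fst_J: "fst q \<in> J" if "q \<in> ?B" for q
    using abs_le_in_J[of "norm q" "fst q"] that norm_fst_le[of "fst q" "snd q"] by simp
  have "convex ?B"
  proof (rule convexI)
    fix a b :: "real \<times> real" and u v :: real
    assume ab: "a \<in> ?B" "b \<in> ?B" and uv: "0 \<le> u" "0 \<le> v" "u + v = 1"
    let ?m = "max (norm a) (norm b)"
    have "norm (u *\<^sub>R a + v *\<^sub>R b) \<le> u * norm a + v * norm b"
      by (rule norm_triangle_le) (use uv in simp)
    also have "\<dots> \<le> u * ?m + v * ?m"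
      using uv by (intro add_mono mult_left_mono) auto
    also have "\<dots> = ?m" using uv(3) by (metis distrib_right mult_1)
    finally have "norm (u *\<^sub>R a + v *\<^sub>R b) \<le> ?m" .
    moreover have "?m \<in> J" using ab by (simp add: max_def)
    ultimately show "u *\<^sub>R a + v *\<^sub>R b \<in> ?B"
      by (auto intro: abs_le_in_J[of ?m])
  qed
  moreover have "continuous_on ?B (\<lambda>q. \<phi> (fst q))"
    by (rule continuous_on_compose2[OF \<phi>_continuous continuous_on_fst[OF continuous_on_id]])
       (use fst_J in blast)
  then have "continuous_on ?B (\<lambda>q. (\<phi> (fst q), snd q))"
    by (intro continuous_intros)
  ultimately have "connected ((\<lambda>q. (\<phi> (fst q), snd q)) ` ?B)"
    by (intro connected_continuous_image convex_connected)
  also have "(\<lambda>q. (\<phi> (fst q), snd q)) ` ?B = region"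
  proof
    show "(\<lambda>q. (\<phi> (fst q), snd q)) ` ?B \<subseteq> region"
    proof
      fix z assume "z \<in> (\<lambda>q. (\<phi> (fst q), snd q)) ` ?B"
      then obtain q where q: "q \<in> ?B" "z = (\<phi> (fst q), snd q)" by blast
      then show "z \<in> region"
        using fst_J[OF q(1)] \<phi>_in_X by (simp add: region_def)
    qed
    show "region \<subseteq> (\<lambda>q. (\<phi> (fst q), snd q)) ` ?B"
    proof clarify
      fix x y assume "(x, y) \<in> region"
      then show "(x, y) \<in> (\<lambda>q. (\<phi> (fst q), snd q)) ` ?B"
        by (intro image_eqI[of _ _ "(\<psi> x, y)"]) (auto simp: region_def)
    qed
  qed
  finally show ?thesis .
qed

lemma periodic_nbhd_region: "periodic_nbhd F 0 region"
  unfolding periodic_nbhd_def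
proof (intro conjI ballI open_region connected_region zero_in_region)
  fix q assume "q \<in> region - {0}"
  then obtain r where "r \<in> J" "0 < r" "q \<in> level r" using region_iff_level by blast
  then show "\<exists>\<gamma>. periodic_orbit F \<gamma> \<and> q \<in> \<gamma> \<and> \<gamma> \<subseteq> region - {0}"
    using periodic_orbit_level region_iff_level by (intro exI[of _ "level r"]) blast
qed

lemma is_center: "is_center F 0"
  using periodic_nbhd_region by (auto simp: is_center_def potential_field_def zero_prod_def)

lemma hamiltonian_on_level:
  "q \<in> level r \<Longrightarrow> hamiltonian (pCons 0 p) q = r\<^sup>2 / 2"
  using \<psi>_square by (auto simp: level_def hamiltonian_eq_potential)

context
  assumes frontier: "periodic_orbit F \<gamma> \<Longrightarrow> \<gamma> \<inter> frontier region = {}"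
begin

text \<open>A connected neighbourhood of the center that leaves the region would contain a point of its
  frontier, and that point would lie on a periodic orbit, which the assumption on the frontier
  excludes.\<close>

lemma period_annulus_eq: "period_annulus F 0 = region - {0}"
proof -
  have "U \<subseteq> region" if U: "periodic_nbhd F 0 U" for U
  proof (rule ccontr)
    assume "\<not> U \<subseteq> region"
    then have "U - region \<noteq> {}" by blast
    moreover have "connected U" "U \<inter> region \<noteq> {}"
      using U zero_in_region by (auto simp: periodic_nbhd_def)
    ultimately obtain q where q: "q \<in> U" "q \<in> frontier region"
      using connected_Int_frontier[of U region] by blast
    then have "q \<noteq> 0"
      using zero_in_region open_region by (auto simp: frontier_def interior_open)
    then obtain \<gamma> where "periodic_orbit F \<gamma>" "q \<in> \<gamma>"
      using U q by (force simp: periodic_nbhd_def)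
    then show False using frontier q by blast
  qed
  then show ?thesis
    using periodic_nbhd_region by (auto simp: period_annulus_def)
qed

lemma energies_eq: "energies (pCons 0 p) = {h. 0 < h \<and> sqrt (2 * h) \<in> J}"
proof
  show "energies (pCons 0 p) \<subseteq> {h. 0 < h \<and> sqrt (2 * h) \<in> J}"
  proof (clarsimp simp: energies_def period_annulus_eq)
    fix x y assume "(x, y) \<in> region" "(x, y) \<noteq> 0"
    then obtain r where "r \<in> J" "0 < r" "(x, y) \<in> level r" using region_iff_level by blast
    moreover from this have *: "hamiltonian (pCons 0 p) (x, y) = r\<^sup>2 / 2"
      using hamiltonian_on_level by blast
    ultimately show "0 < hamiltonian (pCons 0 p) (x, y) \<and> sqrt (2 * hamiltonian (pCons 0 p) (x, y)) \<in> J"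
      unfolding * by simp
  qed
  show "{h. 0 < h \<and> sqrt (2 * h) \<in> J} \<subseteq> energies (pCons 0 p)"
  proof clarify
    fix h :: real assume h: "0 < h" "sqrt (2 * h) \<in> J"
    let ?q = "(0, sqrt (2 * h))"
    have q: "?q \<in> level (sqrt (2 * h))"
      using zero_in_X h by (simp add: level_def)
    then have "?q \<in> region - {0}" using h region_iff_level[of ?q] by auto
    moreover have "hamiltonian (pCons 0 p) ?q = h"
      using hamiltonian_on_level[OF q] h by simp
    ultimately show "h \<in> energies (pCons 0 p)"
      unfolding energies_def period_annulus_eq by (metis image_eqI)
  qed
qed

lemma period_function_eq:
  assumes "h \<in> energies (pCons 0 p)"
  shows "period_function (pCons 0 p) h = T (sqrt (2 * h))"
proof -
  let ?r = "sqrt (2 * h)"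
  have r: "0 < h" "?r \<in> J" "0 < ?r" using assms by (auto simp: energies_eq)
  have "orbit_of_energy (pCons 0 p) h = level ?r"
    unfolding orbit_of_energy_def
  proof (rule the_equality)
    show "periodic_orbit F (level ?r) \<and> level ?r \<subseteq> period_annulus F 0 \<and>
        (\<forall>q\<in>level ?r. hamiltonian (pCons 0 p) q = h)"
    proof (intro conjI ballI subsetI)
      show "periodic_orbit F (level ?r)" by (rule periodic_orbit_level[OF r(2,3)])
      show "q \<in> period_annulus F 0" if "q \<in> level ?r" for q
        using that region_iff_level[of q] r unfolding period_annulus_eq by blast
      show "hamiltonian (pCons 0 p) q = h" if "q \<in> level ?r" for q
        using hamiltonian_on_level[OF that] r(1) by simp
    qed
    fix \<gamma>
    assume \<gamma>: "periodic_orbit F \<gamma> \<and> \<gamma> \<subseteq> period_annulus F 0 \<and>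
        (\<forall>q\<in>\<gamma>. hamiltonian (pCons 0 p) q = h)"
    then obtain q where q: "q \<in> \<gamma>" unfolding periodic_orbit_def by blast
    then have "q \<in> region \<and> q \<noteq> 0" using \<gamma> unfolding period_annulus_eq by blast
    then obtain s where s: "s \<in> J" "0 < s" "q \<in> level s" using region_iff_level by blast
    then have "s\<^sup>2 / 2 = h" using \<gamma> q hamiltonian_on_level by metis
    then have "s = ?r" using s(2) by (auto intro!: real_sqrt_unique[symmetric])
    then show "\<gamma> = level ?r" using periodic_orbit_eq_level s \<gamma> q by blast
  qed
  then show ?thesis
    unfolding period_function_def using orbit_period_level[OF r(2,3)] by simp
qed

end

section \<open>Comparison estimates for the period\<close>

text \<open>While the angle runs through the first quarter turn, the particle moves from the center to its
  right turning point \<open>b\<close> with velocity \<open>\<psi> b * cos u\<close>.\<close>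

lemma first_quarter:
  assumes b: "b \<in> X" "0 < b" and u: "0 \<le> u" "u \<le> pi / 2"
  defines "x \<equiv> \<phi> (\<psi> b * sin u)"
  shows "x \<in> X" "0 \<le> x" "x \<le> b" "\<psi> x = \<psi> b * sin u"
    "\<psi> b * cos u = sqrt (2 * (potential p b - potential p x))"
proof -
  let ?r = "\<psi> b"
  have r: "?r \<in> J" "0 < ?r" using b \<psi>_in_J \<psi>_pos_iff by auto
  have s: "?r * sin u \<in> J" by (rule sin_in_J[OF r(1)])
  show x: "x \<in> X" and \<psi>x: "\<psi> x = ?r * sin u" using s \<phi>_in_X by (auto simp: x_def)
  have sc: "0 \<le> sin u" "0 \<le> cos u" using u by (auto intro: sin_ge_zero cos_ge_zero)
  then have "0 \<le> \<psi> x" "\<psi> x \<le> \<psi> b" using r(2) by (auto simp: \<psi>x mult_le_cancel_left1)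
  then show "0 \<le> x" "x \<le> b"
    using \<psi>_neg_iff[OF x] \<psi>_strict_mono[OF b(1) x] by force+
  have "(?r * cos u)\<^sup>2 = ?r\<^sup>2 - (\<psi> x)\<^sup>2"
    by (simp add: \<psi>x power_mult_distrib cos_squared_eq algebra_simps)
  also have "\<dots> = 2 * (potential p b - potential p x)"
    by (simp add: \<psi>_square x b)
  finally show "?r * cos u = sqrt (2 * (potential p b - potential p x))"
    using sc r(2) by (intro real_sqrt_unique[symmetric]) auto
qed

lemma angle_exists:
  assumes b: "b \<in> X" "0 < b" and x: "0 \<le> x" "x \<le> b"
  shows "\<exists>u. 0 \<le> u \<and> u \<le> pi / 2 \<and> \<phi> (\<psi> b * sin u) = x \<and> \<psi> b * sin u = \<psi> x"
proof -
  let ?u = "arcsin (\<psi> x / \<psi> b)"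
  have X: "x \<in> X" using between_in_X[OF zero_in_X b(1)] x by simp
  have r: "0 < \<psi> b" using b \<psi>_pos_iff by simp
  have "0 \<le> \<psi> x" using \<psi>_neg_iff[OF X] x by auto
  moreover have "\<psi> x \<le> \<psi> b" using \<psi>_strict_mono[OF X b(1)] x by force
  ultimately have "0 \<le> \<psi> x / \<psi> b" "\<psi> x / \<psi> b \<le> 1" using r by auto
  then have "-1 \<le> \<psi> x / \<psi> b" "\<psi> x / \<psi> b \<le> 1" "0 \<le> \<psi> x / \<psi> b" by linarith+
  then have "0 \<le> ?u" "?u \<le> pi / 2" and eq: "\<psi> b * sin ?u = \<psi> x"
    using r arcsin_le_arcsin[of 0 "\<psi> x / \<psi> b"] arcsin_bounded[of "\<psi> x / \<psi> b"] by auto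
  moreover have "\<phi> (\<psi> b * sin ?u) = x" using X by (simp add: eq)
  ultimately show ?thesis by blast
qed

lemma angle_mono:
  assumes "b \<in> X" "0 < b" "0 \<le> u" "u \<le> v" "v \<le> pi / 2"
  shows "\<phi> (\<psi> b * sin u) \<le> \<phi> (\<psi> b * sin v)"
proof -
  have "sin u \<le> sin v" using assms by (intro sin_monotone_2pi_le) auto
  then have "\<psi> (\<phi> (\<psi> b * sin u)) \<le> \<psi> (\<phi> (\<psi> b * sin v))"
    using assms \<psi>_pos_iff[of b] \<psi>_in_J[of b] sin_in_J by (simp add: mult_left_mono)
  then show ?thesis
    using \<psi>_strict_mono \<phi>_in_X sin_in_J \<psi>_in_J assms(1) by (metis linorder_not_less)
qed

lemma angle_less:
  assumes "b \<in> X" "0 < b" "0 \<le> u" "u \<le> pi / 2" "0 \<le> v" "v \<le> pi / 2"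
    and "\<phi> (\<psi> b * sin u) < \<phi> (\<psi> b * sin v)"
  shows "u < v"
  using angle_mono[of b v u] assms by force

lemma \<phi>_sin_DERIV:
  assumes "r \<in> J"
  shows "((\<lambda>u. \<phi> (r * sin u)) has_real_derivative d\<phi> (r * sin u) * (r * cos u)) (at u)"
  by (rule DERIV_chain2[where f = \<phi> and g = "\<lambda>u. r * sin u", OF \<phi>_DERIV[OF sin_in_J[OF assms]]]) (auto intro!: derivative_eq_intros)

text \<open>If \<open>W\<close> grows at most at unit rate along the orbit, that is \<open>W' x * y \<le> 1\<close> with the velocity
  \<open>y = sqrt (2 * (potential p b - potential p x))\<close>, then the passage from \<open>x1\<close> to \<open>x2\<close> takes at least the
  time \<open>W x2 - W x1\<close>. Each half turn contains this passage once.\<close>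

lemma period_lower_bound:
  assumes b: "b \<in> X" and x: "0 \<le> x1" "x1 < x2" "x2 \<le> b"
    and W: "\<And>x. x1 \<le> x \<Longrightarrow> x \<le> x2 \<Longrightarrow> (W has_real_derivative W' x) (at x)"
    and le: "\<And>x. x1 \<le> x \<Longrightarrow> x \<le> x2 \<Longrightarrow> W' x * sqrt (2 * (potential p b - potential p x)) \<le> 1"
  shows "2 * (W x2 - W x1) \<le> T (\<psi> b)"
proof -
  have b0: "0 < b" using x by simp
  let ?r = "\<psi> b"
  let ?x = "\<lambda>u. \<phi> (?r * sin u)"
  have r: "?r \<in> J" using b \<psi>_in_J by auto
  obtain P where P: "clock ?r P" using clock_exists[OF r] .
  obtain u1 where u1: "0 \<le> u1" "u1 \<le> pi / 2" "?x u1 = x1"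
    using angle_exists[OF b b0 x(1)] x by force
  obtain u2 where u2: "0 \<le> u2" "u2 \<le> pi / 2" "?x u2 = x2"
    using angle_exists[OF b b0 _ x(3)] x by force
  have u12: "u1 < u2" using angle_less[OF b b0] u1 u2 x by simp
  have "P u1 - W (?x u1) \<le> P u2 - W (?x u2)"
  proof (rule DERIV_nonneg_imp_nondecreasing[of u1 u2 "\<lambda>u. P u - W (?x u)"])
    show "u1 \<le> u2" using u12 by simp
    fix u assume u: "u1 \<le> u" "u \<le> u2"
    have q: "0 \<le> u" "u \<le> pi / 2" using u u1 u2 by auto
    have xu: "x1 \<le> ?x u" "?x u \<le> x2"
      using angle_mono[OF b b0, of u1 u] angle_mono[OF b b0, of u u2] u u1 u2 by auto
    have d: "0 < d\<phi> (?r * sin u)" using d\<phi>_pos sin_in_J r by blast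
    have "((\<lambda>u. P u - W (?x u)) has_real_derivative
        d\<phi> (?r * sin u) - W' (?x u) * (d\<phi> (?r * sin u) * (?r * cos u))) (at u)"
      by (rule DERIV_diff[OF P[unfolded clock_def, rule_format]
            DERIV_chain2[OF W[OF xu] \<phi>_sin_DERIV[OF r]]])
    moreover have "d\<phi> (?r * sin u) - W' (?x u) * (d\<phi> (?r * sin u) * (?r * cos u)) =
        d\<phi> (?r * sin u) * (1 - W' (?x u) * (?r * cos u))"
      by (simp add: algebra_simps)
    moreover have "0 \<le> 1 - W' (?x u) * (?r * cos u)"
      using le[OF xu] first_quarter(5)[OF b b0 q] by simp
    ultimately show "\<exists>y. ((\<lambda>u. P u - W (?x u)) has_real_derivative y) (at u) \<and> 0 \<le> y"
      using d by (metis less_imp_le mult_nonneg_nonneg)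
  qed
  then have "W x2 - W x1 \<le> P u2 - P u1" using u1 u2 by simp
  also have "\<dots> \<le> P (pi / 2) - P (- pi / 2)"
  proof -
    have mono: "a \<le> c \<Longrightarrow> P a \<le> P c" for a c
      using clock_strict_mono[OF P r, of a c] by (cases "a = c") auto
    have "- pi / 2 \<le> u1" using u1(1) pi_gt_zero by linarith
    then show ?thesis using mono[OF u2(2)] mono[of "- pi / 2" u1] by simp
  qed
  finally show ?thesis using clock_T[OF P] by simp
qed

text \<open>On the left of the center the stiffness \<open>p\<close> decreases towards the center, so the potential at \<open>x\<close>
  is at most that of the harmonic oscillator of stiffness \<open>poly p x\<close>. Together with
  \<open>\<psi> x * d\<psi> x = x * poly p x\<close> this bounds \<open>d\<psi>\<close> from below, hence the time element \<open>d\<phi>\<close> from above.\<close>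

lemma d\<psi>_ge_sqrt:
  assumes x: "x \<in> X" "x \<le> 0" and q: "0 \<le> q" "q \<le> poly p 0"
    and anti: "\<And>a c. a \<le> c \<Longrightarrow> c \<le> 0 \<Longrightarrow> poly p c \<le> poly p a"
  shows "sqrt q \<le> d\<psi> x"
proof (cases "x = 0")
  case True
  then show ?thesis using q by (simp add: d\<psi>_def potential_quotient_0)
next
  case False
  then have x0: "x < 0" using x by simp
  have q': "q \<le> poly p x" using anti[of x 0] x q by simp
  have "potential p x - x\<^sup>2 * poly p x / 2 \<le> potential p 0 - 0\<^sup>2 * poly p x / 2"
  proof (rule DERIV_nonneg_imp_nondecreasing[OF x(2)])
    fix t assume t: "x \<le> t" "t \<le> 0"
    have "((\<lambda>t. potential p t - t\<^sup>2 * poly p x / 2) has_real_derivative t * (poly p t - poly p x)) (at t)"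
      by (rule DERIV_cong[OF DERIV_diff[OF potential_DERIV DERIV_cdivide[OF DERIV_cmult_right[OF DERIV_pow]]]])
         (simp add: algebra_simps)
    moreover have "0 \<le> t * (poly p t - poly p x)"
      using anti[of x t] t by (intro mult_nonpos_nonpos) auto
    ultimately show "\<exists>y. ((\<lambda>t. potential p t - t\<^sup>2 * poly p x / 2) has_real_derivative y) (at t) \<and> 0 \<le> y"
      by blast
  qed
  then have "(\<psi> x)\<^sup>2 \<le> x\<^sup>2 * poly p x" using \<psi>_square[OF x(1)] by simp
  then have "(\<psi> x)\<^sup>2 * q \<le> (x\<^sup>2 * poly p x) * poly p x"
    using q' q p_pos[OF x(1)] by (intro mult_mono) auto
  also have "\<dots> = (\<psi> x)\<^sup>2 * (d\<psi> x)\<^sup>2"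
    using \<psi>_times_d\<psi>[OF x(1)] by (simp add: power2_eq_square algebra_simps flip: power_mult_distrib)
  finally have "q \<le> (d\<psi> x)\<^sup>2"
    using \<psi>_neg_iff[OF x(1)] x0 by (simp add: mult_le_cancel_left_pos zero_less_power2)
  then show ?thesis
    using d\<psi>_pos[OF x(1)] by (simp add: real_le_lsqrt)
qed

text \<open>Half a turn is split into three parts. On the left of the center the time element is at most
  \<open>1 / sqrt q\<close> over an angle of \<open>pi / 2\<close>. From the center to \<open>c\<close> the velocity is at least \<open>\<eta>\<close>, however
  small the force may be there; this takes at most the time \<open>c / \<eta>\<close>. From \<open>c\<close> to the turning point \<open>b\<close>
  the velocity drops from \<open>\<eta>\<close> to \<open>0\<close> at a rate of at least \<open>m\<close>, which takes at most \<open>\<eta> / m\<close>.\<close>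

lemma period_upper_bound:
  assumes b: "b \<in> X" and c: "0 < c" "c < b"
    and m: "0 < m" "\<And>x. c \<le> x \<Longrightarrow> x \<le> b \<Longrightarrow> m \<le> x * poly p x"
    and q: "0 < q" "q \<le> poly p 0" "\<And>a c. a \<le> c \<Longrightarrow> c \<le> 0 \<Longrightarrow> poly p c \<le> poly p a"
  defines "\<eta> \<equiv> sqrt (2 * (potential p b - potential p c))"
  shows "T (\<psi> b) \<le> 2 * (c / \<eta> + \<eta> / m + pi / (2 * sqrt q))"
proof -
  have b0: "0 < b" using c by simp
  let ?r = "\<psi> b"
  let ?x = "\<lambda>u. \<phi> (?r * sin u)"
  have r: "?r \<in> J" using b \<psi>_in_J by auto
  have r0: "0 < ?r" using \<psi>_pos_iff b b0 by simp
  obtain P where P: "clock ?r P" using clock_exists[OF r] .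
  note derP = P[unfolded clock_def, rule_format]
  obtain u1 where u1: "0 \<le> u1" "u1 \<le> pi / 2" "?x u1 = c" "?r * sin u1 = \<psi> c"
    using angle_exists[OF b b0, of c] c by force
  have \<eta>: "?r * cos u1 = \<eta>"
    using first_quarter(5)[OF b b0 u1(1,2)] u1(3) by (simp add: \<eta>_def)
  have cX: "c \<in> X" using between_in_X[OF zero_in_X b] c by simp
  have "\<psi> c < \<psi> b" by (rule \<psi>_strict_mono[OF cX b c(2)])
  then have "(\<psi> c)\<^sup>2 < (\<psi> b)\<^sup>2" using \<psi>_pos_iff[OF cX] c by (intro power_strict_mono) auto
  then have \<eta>0: "0 < \<eta>" by (simp add: \<eta>_def \<psi>_square cX b)
  have left: "P 0 - P (- pi / 2) \<le> pi / (2 * sqrt q)"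
  proof -
    have "P (- pi / 2) - (- pi / 2) / sqrt q \<ge> P 0 - 0 / sqrt q"
    proof (rule DERIV_nonpos_imp_nonincreasing[of "- pi / 2" 0])
      show "- pi / 2 \<le> 0" by simp
      fix u :: real assume u: "- pi / 2 \<le> u" "u \<le> 0"
      have s: "?r * sin u \<in> J" by (rule sin_in_J[OF r])
      have "sin u \<le> 0" using sin_ge_zero[of "- u"] u by simp
      then have "?r * sin u \<le> 0" using r0 by (simp add: mult_le_0_iff)
      then have "?x u \<le> 0" using \<psi>_pos_iff[OF \<phi>_in_X[OF s]] s by (simp add: not_less[symmetric])
      then have "sqrt q \<le> d\<psi> (?x u)"
        by (intro d\<psi>_ge_sqrt[OF \<phi>_in_X[OF s]]) (use q in auto)
      then have "d\<phi> (?r * sin u) - 1 / sqrt q \<le> 0"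
        using q(1) by (simp add: d\<phi>_def divide_inverse le_imp_inverse_le)
      moreover have "((\<lambda>u. P u - u / sqrt q) has_real_derivative d\<phi> (?r * sin u) - 1 / sqrt q) (at u)"
        by (intro DERIV_diff derP DERIV_cdivide DERIV_ident)
      ultimately show "\<exists>y. ((\<lambda>u. P u - u / sqrt q) has_real_derivative y) (at u) \<and> y \<le> 0" by blast
    qed
    then show ?thesis by simp
  qed
  have middle: "P u1 - P 0 \<le> c / \<eta>"
  proof -
    have "P 0 - ?x 0 / \<eta> \<ge> P u1 - ?x u1 / \<eta>"
    proof (rule DERIV_nonpos_imp_nonincreasing[OF u1(1)])
      fix u assume u: "0 \<le> u" "u \<le> u1"
      have "cos u1 \<le> cos u" using u u1 by (intro cos_monotone_0_pi_le) auto
      then have "\<eta> \<le> ?r * cos u" using r0 by (simp flip: \<eta>)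
      then have "1 - ?r * cos u / \<eta> \<le> 0" using \<eta>0 by simp
      moreover have "0 < d\<phi> (?r * sin u)" using d\<phi>_pos sin_in_J r by blast
      ultimately have "d\<phi> (?r * sin u) * (1 - ?r * cos u / \<eta>) \<le> 0"
        by (intro mult_nonneg_nonpos) auto
      then have "d\<phi> (?r * sin u) - d\<phi> (?r * sin u) * (?r * cos u) / \<eta> \<le> 0"
        by (simp add: algebra_simps)
      moreover have "((\<lambda>u. P u - ?x u / \<eta>) has_real_derivative
          d\<phi> (?r * sin u) - d\<phi> (?r * sin u) * (?r * cos u) / \<eta>) (at u)"
        by (intro DERIV_diff derP DERIV_cdivide \<phi>_sin_DERIV r)
      ultimately show "\<exists>y. ((\<lambda>u. P u - ?x u / \<eta>) has_real_derivative y) (at u) \<and> y \<le> 0" by blast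
    qed
    moreover have "?x 0 = 0" using \<phi>_\<psi>[OF zero_in_X] by simp
    ultimately show ?thesis using u1(3) by simp
  qed
  have right: "P (pi / 2) - P u1 \<le> \<eta> / m"
  proof -
    have "P u1 + ?r * cos u1 / m \<ge> P (pi / 2) + ?r * cos (pi / 2) / m"
    proof (rule DERIV_nonpos_imp_nonincreasing[OF u1(2)])
      fix u assume u: "u1 \<le> u" "u \<le> pi / 2"
      have s: "?r * sin u \<in> J" by (rule sin_in_J[OF r])
      have "c \<le> ?x u" using angle_mono[OF b b0, of u1 u] u u1 by simp
      moreover have "?x u \<le> b" using first_quarter(3)[OF b b0, of u] u u1 by simp
      ultimately have "m \<le> ?x u * poly p (?x u)" by (rule m(2))
      then have "d\<phi> (?r * sin u) * m \<le> ?r * sin u"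
        using d\<phi>_times_force[OF s] d\<phi>_pos[OF s] by (metis less_imp_le mult_left_mono)
      then have "d\<phi> (?r * sin u) + ?r * (- sin u) / m \<le> 0"
        using m(1) by (simp add: field_simps)
      moreover have "((\<lambda>u. P u + ?r * cos u / m) has_real_derivative
          d\<phi> (?r * sin u) + ?r * (- sin u) / m) (at u)"
        by (intro DERIV_add derP DERIV_cdivide DERIV_cmult DERIV_cos)
      ultimately show "\<exists>y. ((\<lambda>u. P u + ?r * cos u / m) has_real_derivative y) (at u) \<and> y \<le> 0" by blast
    qed
    then show ?thesis by (simp add: \<eta>)
  qed
  show ?thesis
    unfolding clock_T[OF P] using left middle right by simp
qed

end

section \<open>Oscillation of the period function\<close>

lemma local_extremum_between_lower_values:
  fixes T :: "real \<Rightarrow> real"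
  assumes cont: "continuous_on {l..r} T" and m: "l < m" "m < r"
    and T: "T l \<le> B" "B < T m" "T r \<le> B"
  shows "\<exists>c. l < c \<and> c < r \<and> B < T c \<and> (\<forall>\<^sub>F s in at c within I. T s \<le> T c)"
proof -
  obtain c where c: "c \<in> {l..r}" "\<And>s. s \<in> {l..r} \<Longrightarrow> T s \<le> T c"
    using continuous_attains_sup[OF compact_Icc _ cont] m by force
  have "B < T c" using c(2)[of m] m T by simp
  then have "c \<noteq> l" "c \<noteq> r" using T by auto
  then have lr: "l < c" "c < r" using c(1) by auto
  have "\<forall>\<^sub>F s in at c within I. T s \<le> T c"
    unfolding eventually_at_topological
    by (intro exI[of _ "{l<..<r}"]) (use lr c(2) in auto)
  then show ?thesis using lr \<open>B < T c\<close> by blast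
qed

lemma local_extremum_between_upper_values:
  fixes T :: "real \<Rightarrow> real"
  assumes cont: "continuous_on {l..r} T" and m: "l < m" "m < r"
    and T: "B < T l" "T m \<le> B" "B < T r"
  shows "\<exists>c. l < c \<and> c < r \<and> T c \<le> B \<and> (\<forall>\<^sub>F s in at c within I. T c \<le> T s)"
proof -
  obtain c where c: "c \<in> {l..r}" "\<And>s. s \<in> {l..r} \<Longrightarrow> T c \<le> T s"
    using continuous_attains_inf[OF compact_Icc _ cont] m by force
  have "T c \<le> B" using c(2)[of m] m T by simp
  then have "c \<noteq> l" "c \<noteq> r" using T by auto
  then have lr: "l < c" "c < r" using c(1) by auto
  have "\<forall>\<^sub>F s in at c within I. T c \<le> T s"
    unfolding eventually_at_topological
    by (intro exI[of _ "{l<..<r}"]) (use lr c(2) in auto)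
  then show ?thesis using lr \<open>T c \<le> B\<close> by blast
qed

text \<open>Between \<open>z i\<close> and \<open>z (i + 2)\<close> there is a local maximum with value above \<open>B\<close> for even \<open>i\<close> and a
  local minimum with value at most \<open>B\<close> for odd \<open>i\<close>. These are distinct: for indices of different parity
  the values differ, and for indices of equal parity the intervals are disjoint.\<close>

lemma oscillation_gives_local_extrema:
  fixes T :: "real \<Rightarrow> real" and z :: "nat \<Rightarrow> real"
  assumes cont: "continuous_on I T"
    and interval: "\<And>a b x. a \<in> I \<Longrightarrow> b \<in> I \<Longrightarrow> a \<le> x \<Longrightarrow> x \<le> b \<Longrightarrow> x \<in> I"
    and z: "\<And>i. i \<le> L \<Longrightarrow> z i \<in> I" "\<And>i. i < L \<Longrightarrow> z i < z (Suc i)"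
    and low: "\<And>i. i \<le> L \<Longrightarrow> even i \<Longrightarrow> T (z i) \<le> B"
    and high: "\<And>i. i \<le> L \<Longrightarrow> odd i \<Longrightarrow> B < T (z i)"
    and C: "C = {h \<in> I. (\<forall>\<^sub>F s in at h within I. T s \<le> T h) \<or> (\<forall>\<^sub>F s in at h within I. T h \<le> T s)}"
    and fin: "finite C"
  shows "L - 1 \<le> card C"
proof -
  have "\<exists>c. z i < c \<and> c < z (Suc (Suc i)) \<and> c \<in> C \<and> (if even i then B < T c else T c \<le> B)"
    if i: "i < L - 1" for i
  proof -
    have i': "i \<le> L" "Suc i \<le> L" "Suc (Suc i) \<le> L" "i < L" "Suc i < L" using i by auto
    have sub: "{z i..z (Suc (Suc i))} \<subseteq> I"
      using interval[OF z(1)[OF i'(1)] z(1)[OF i'(3)]] by auto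
    note cont' = continuous_on_subset[OF cont sub]
    show ?thesis
    proof (cases "even i")
      case True
      with local_extremum_between_lower_values[OF cont' z(2)[OF i'(4)] z(2)[OF i'(5)], of B I]
      obtain c where "z i < c" "c < z (Suc (Suc i))" "B < T c" "\<forall>\<^sub>F s in at c within I. T s \<le> T c"
        using low[OF i'(1)] high[OF i'(2)] low[OF i'(3)] by auto
      moreover from this have "c \<in> I" using sub by auto
      ultimately show ?thesis using True C by auto
    next
      case False
      with local_extremum_between_upper_values[OF cont' z(2)[OF i'(4)] z(2)[OF i'(5)], of B I]
      obtain c where "z i < c" "c < z (Suc (Suc i))" "T c \<le> B" "\<forall>\<^sub>F s in at c within I. T c \<le> T s"
        using high[OF i'(1)] low[OF i'(2)] high[OF i'(3)] by auto
      moreover from this have "c \<in> I" using sub by auto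
      ultimately show ?thesis using False C by auto
    qed
  qed
  then obtain c where c: "\<And>i. i < L - 1 \<Longrightarrow> z i < c i \<and> c i < z (Suc (Suc i)) \<and> c i \<in> C \<and>
      (if even i then B < T (c i) else T (c i) \<le> B)"
    by metis
  have zmono: "z i \<le> z j" if "i \<le> j" "j \<le> L" for i j
    using that
  proof (induction j rule: dec_induct)
    case (step j)
    then show ?case using z(2)[of j] by simp
  qed simp
  have "c i \<noteq> c j" if ij: "i < j" "j < L - 1" for i j
  proof (cases "even i = even j")
    case True
    then have "Suc (Suc i) \<le> j" using ij(1) by (cases "j = Suc i") auto
    then have "z (Suc (Suc i)) \<le> z j" using ij by (intro zmono) auto
    then show ?thesis using c[of i] c[of j] ij by force
  next
    case False
    then show ?thesis using c[of i] c[of j] ij by (auto split: if_splits)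
  qed
  then have "inj_on c {..<L - 1}"
    by (intro inj_onI) (metis lessThan_iff linorder_neqE_nat)
  moreover have "c ` {..<L - 1} \<subseteq> C" using c by blast
  ultimately show ?thesis
    using card_inj_on_le[OF _ _ fin] by fastforce
qed

lemma num_critical_periods_ge_of_oscillation:
  fixes z :: "nat \<Rightarrow> real"
  assumes cont: "continuous_on (energies g) (period_function g)"
    and interval: "\<And>a b x. a \<in> energies g \<Longrightarrow> b \<in> energies g \<Longrightarrow> a \<le> x \<Longrightarrow> x \<le> b \<Longrightarrow> x \<in> energies g"
    and z: "\<And>i. i \<le> L \<Longrightarrow> z i \<in> energies g" "\<And>i. i < L \<Longrightarrow> z i < z (Suc i)"
    and low: "\<And>i. i \<le> L \<Longrightarrow> even i \<Longrightarrow> period_function g (z i) \<le> B"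
    and high: "\<And>i. i \<le> L \<Longrightarrow> odd i \<Longrightarrow> B < period_function g (z i)"
  shows "enat (L - 1) \<le> num_critical_periods g"
proof (cases "2 \<le> L")
  case False
  then have "L - 1 = 0" by simp
  then show ?thesis by (simp only: zero_enat_def[symmetric]) simp
next
  case True
  let ?T = "period_function g" and ?I = "energies g"
  let ?C = "{h \<in> ?I. (\<forall>\<^sub>F s in at h within ?I. ?T s \<le> ?T h) \<or> (\<forall>\<^sub>F s in at h within ?I. ?T h \<le> ?T s)}"
  have *: "?T (z 0) < ?T (z 1)" "?T (z 2) < ?T (z 1)" "z 0 < z 1" "z 1 < z 2"
    "z 0 \<in> ?I" "z 1 \<in> ?I" "z 2 \<in> ?I"
    using low[of 0] high[of 1] low[of 2] z(2)[of 0] z(2)[of 1] z(1)[of 0] z(1)[of 1] z(1)[of 2] True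
    by (auto simp: numeral_2_eq_2)
  have "\<not> monotone_on ?I (\<le>) (\<le>) ?T" "\<not> monotone_on ?I (\<le>) (\<ge>) ?T"
    using * by (force simp: monotone_on_def)+
  then have C: "critical_energies g = ?C"
    by (simp add: critical_energies_def Let_def)
  show ?thesis
    unfolding num_critical_periods_def C
    using oscillation_gives_local_extrema[where T = ?T and I = ?I and z = z and B = B and C = ?C and L = L,
        OF cont interval z low high refl] by simp
qed

context potential_well
begin

text \<open>The orbits are given by their right turning points \<open>b i\<close> instead of their energies.\<close>

lemma num_critical_periods_ge_of_oscillation_at_amplitudes:
  fixes b :: "nat \<Rightarrow> real"
  assumes frontier: "\<And>\<gamma>. periodic_orbit F \<gamma> \<Longrightarrow> \<gamma> \<inter> frontier region = {}"
    and b: "\<And>i. i \<le> L \<Longrightarrow> b i \<in> X" "\<And>i. i \<le> L \<Longrightarrow> 0 < b i" "\<And>i. i < L \<Longrightarrow> b i < b (Suc i)"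
    and low: "\<And>i. i \<le> L \<Longrightarrow> even i \<Longrightarrow> T (\<psi> (b i)) \<le> B"
    and high: "\<And>i. i \<le> L \<Longrightarrow> odd i \<Longrightarrow> B < T (\<psi> (b i))"
  shows "enat (L - 1) \<le> num_critical_periods (pCons 0 p)"
proof -
  let ?I = "energies (pCons 0 p)"
  let ?z = "\<lambda>i. (\<psi> (b i))\<^sup>2 / 2"
  have E: "?I = {h. 0 < h \<and> sqrt (2 * h) \<in> J}"
    by (rule energies_eq) (rule frontier)
  have PF: "period_function (pCons 0 p) h = T (sqrt (2 * h))" if "h \<in> ?I" for h
    using that frontier by (intro period_function_eq)
  have sq: "sqrt (2 * ?z i) = \<psi> (b i)" "0 < \<psi> (b i)" "\<psi> (b i) \<in> J" if "i \<le> L" for i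
    using b(1,2)[OF that] \<psi>_pos_iff[of "b i"] \<psi>_in_J by auto
  have zI: "?z i \<in> ?I" if "i \<le> L" for i
    using sq[OF that] unfolding E by simp
  have pf: "period_function (pCons 0 p) (?z i) = T (\<psi> (b i))" if "i \<le> L" for i
    using PF[OF zI[OF that]] sq[OF that] by simp
  show ?thesis
  proof (rule num_critical_periods_ge_of_oscillation[where z = ?z and B = B])
    have "continuous_on ?I (\<lambda>h. T (sqrt (2 * h)))"
      by (rule continuous_on_compose2[OF T_continuous])
         (auto simp: E intro!: continuous_intros)
    then show "continuous_on ?I (period_function (pCons 0 p))"
      using PF by (simp cong: continuous_on_cong)
    show "x \<in> ?I" if "u \<in> ?I" "v \<in> ?I" "u \<le> x" "x \<le> v" for u v x
      using that between_in_J[of "sqrt (2 * u)" "sqrt (2 * v)" "sqrt (2 * x)"] unfolding E by auto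
    show "?z i < ?z (Suc i)" if "i < L" for i
      using sq[of i] sq[of "Suc i"] \<psi>_strict_mono[OF b(1) b(1) b(3)[OF that]] that
      by (simp add: power_strict_mono)
  qed (use zI pf low high in auto)
qed

end

section \<open>Energy estimates and homoclinic loops\<close>

lemma potential_diff_bounds:
  assumes "a \<le> b" and "\<And>x. a \<le> x \<Longrightarrow> x \<le> b \<Longrightarrow> m \<le> x * poly p x"
    and "\<And>x. a \<le> x \<Longrightarrow> x \<le> b \<Longrightarrow> x * poly p x \<le> M"
  shows "m * (b - a) \<le> potential p b - potential p a" "potential p b - potential p a \<le> M * (b - a)"
proof -
  have "m * (b - a) \<le> potential p b - potential p a \<and> potential p b - potential p a \<le> M * (b - a)"
  proof (cases "a = b")
    case False
    then obtain z where z: "a < z" "z < b" "potential p b - potential p a = (b - a) * (z * poly p z)"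
      using MVT2[of a b "potential p" "\<lambda>x. x * poly p x"] potential_DERIV assms(1) by auto
    show ?thesis
      using assms(2)[of z] assms(3)[of z] z by (simp add: mult.commute mult_left_mono)
  qed simp
  then show "m * (b - a) \<le> potential p b - potential p a" "potential p b - potential p a \<le> M * (b - a)"
    by auto
qed

lemma potential_ge_quadratic:
  assumes "\<And>t. \<bar>t\<bar> \<le> \<bar>x\<bar> \<Longrightarrow> 0 \<le> t * x \<Longrightarrow> \<mu> \<le> poly p t"
  shows "\<mu> * x\<^sup>2 / 2 \<le> potential p x"
proof -
  have der: "((\<lambda>t. potential p t - \<mu> * t\<^sup>2 / 2) has_real_derivative t * (poly p t - \<mu>)) (at t)" for t
    by (rule DERIV_cong[OF DERIV_diff[OF potential_DERIV DERIV_cdivide[OF DERIV_cmult[OF DERIV_pow]]]])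
       (simp add: algebra_simps)
  have "potential p 0 - \<mu> * 0\<^sup>2 / 2 \<le> potential p x - \<mu> * x\<^sup>2 / 2"
  proof (cases "0 \<le> x")
    case True
    then show ?thesis
    proof (rule DERIV_nonneg_imp_nondecreasing)
      fix t assume "0 \<le> t" "t \<le> x"
      then have "0 \<le> t * (poly p t - \<mu>)" using assms[of t] True by simp
      then show "\<exists>y. ((\<lambda>t. potential p t - \<mu> * t\<^sup>2 / 2) has_real_derivative y) (at t) \<and> 0 \<le> y"
        using der by blast
    qed
  next
    case False
    then have "x \<le> 0" by simp
    then show ?thesis
    proof (rule DERIV_nonpos_imp_nonincreasing)
      fix t assume "x \<le> t" "t \<le> 0"
      then have "t * (poly p t - \<mu>) \<le> 0"
        using assms[of t] False by (simp add: mult_le_0_iff mult_nonpos_nonpos)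
      then show "\<exists>y. ((\<lambda>t. potential p t - \<mu> * t\<^sup>2 / 2) has_real_derivative y) (at t) \<and> y \<le> 0"
        using der by blast
    qed
  qed
  then show ?thesis by simp
qed

lemma hamiltonian_conserved:
  assumes "is_solution (potential_field (pCons 0 p)) u"
  shows "hamiltonian (pCons 0 p) (u s) = hamiltonian (pCons 0 p) (u t)"
proof -
  have "((\<lambda>t. (snd (u t))\<^sup>2 / 2 + potential p (fst (u t))) has_real_derivative 0) (at t)" for t
    using assms[unfolded is_solution_potential_iff, rule_format, of t]
    by (auto intro!: derivative_eq_intros DERIV_chain2[OF potential_DERIV])
  then have "(snd (u s))\<^sup>2 / 2 + potential p (fst (u s)) = (snd (u t))\<^sup>2 / 2 + potential p (fst (u t))"
    using DERIV_isconst_all[of "\<lambda>t. (snd (u t))\<^sup>2 / 2 + potential p (fst (u t))"] by blast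
  then show ?thesis
    using hamiltonian_eq_potential[of p "fst (u s)" "snd (u s)"]
      hamiltonian_eq_potential[of p "fst (u t)" "snd (u t)"] by simp
qed

text \<open>A periodic orbit on the energy level of the saddle \<open>(c, 0)\<close> avoids the saddle itself, so it stays
  in \<open>a \<le> x < c\<close>. At its rightmost point the velocity vanishes, and on the loop this happens only at
  \<open>x = a\<close>. Hence \<open>x\<close> is constantly \<open>a\<close>, which contradicts the nonzero force at \<open>a\<close>.\<close>

lemma no_periodic_orbit_on_homoclinic_loop:
  assumes saddle: "poly p c = 0"
    and ac: "a < 0" "0 < c" "poly p a \<noteq> 0" "potential p a = potential p c"
    and inside: "\<And>x. a < x \<Longrightarrow> x < c \<Longrightarrow> potential p x < potential p c"
    and outside: "\<And>x. x < a \<Longrightarrow> potential p c < potential p x"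
    and \<gamma>: "periodic_orbit (potential_field (pCons 0 p)) \<gamma>"
    and q: "(x, y) \<in> \<gamma>" "x \<le> c" "y\<^sup>2 / 2 + potential p x = potential p c"
  shows False
proof -
  obtain u \<tau> where u: "is_solution (potential_field (pCons 0 p)) u" "minimal_period u \<tau>" "range u = \<gamma>"
    using \<gamma> by (auto simp: periodic_orbit_def)
  obtain s where s: "u s = (x, y)" using q(1) u(3) by (metis imageE)
  let ?x = "\<lambda>t. fst (u t)" and ?y = "\<lambda>t. snd (u t)"
  have dx: "(?x has_real_derivative ?y t) (at t)"
    and dy: "(?y has_real_derivative - (?x t * poly p (?x t))) (at t)" for t
    using u(1) by (auto simp: is_solution_potential_iff)
  have H: "(?y t)\<^sup>2 / 2 + potential p (?x t) = potential p c" for t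
    using hamiltonian_conserved[OF u(1), of t s] q(3) s
      hamiltonian_eq_potential[of p "?x t" "?y t"] hamiltonian_eq_potential[of p x y] by simp
  have not_c: "?x t \<noteq> c" for t
  proof
    assume *: "?x t = c"
    then have "?y t = 0" using H[of t] by simp
    then have "(c, 0) \<in> \<gamma>" using * u(3) by (metis prod.collapse rangeI)
    moreover have "(c, 0) \<notin> \<gamma>"
      by (rule no_periodic_orbit_through_equilibrium[OF _ \<gamma>]) (use saddle in simp)
    ultimately show False by simp
  qed
  have compact: "compact (?x ` UNIV)"
    using compact_continuous_image[OF continuous_on_fst[OF continuous_on_id] compact_periodic_range[OF u(1,2)]]
    by (simp add: image_image)
  have less_c: "?x t < c" for t
  proof (rule ccontr)
    assume "\<not> ?x t < c"
    moreover have "?x s \<le> c" using s q(2) by simp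
    moreover have "connected (range ?x)"
      by (intro connected_continuous_image continuous_on_fst is_solution_continuous[OF u(1)]) simp
    ultimately have "c \<in> range ?x"
      using connected_contains_Icc[of "range ?x" "?x s" "?x t"] by auto
    then show False using not_c by auto
  qed
  have ge_a: "a \<le> ?x t" for t
    using outside[of "?x t"] H[of t] zero_le_power2[of "?y t"] by (smt (verit) divide_nonneg_pos)
  obtain t0 where t0: "\<And>t. ?x t \<le> ?x t0"
    using compact_attains_sup[OF compact] by blast
  have "?y t0 = 0"
    by (rule DERIV_local_max[OF dx, of 1]) (use t0 in auto)
  then have "potential p (?x t0) = potential p c" using H[of t0] by simp
  then have "?x t0 = a" using inside[of "?x t0"] ge_a[of t0] less_c[of t0] by force
  then have xa: "?x t = a" for t using t0[of t] ge_a[of t] by simp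
  then have "?y t = 0" for t using dx[of t] DERIV_unique[OF DERIV_const[of a]] by (metis (no_types, lifting) ext)
  then have "- (a * poly p a) = 0"
    using dy[of 0] DERIV_unique[OF DERIV_const[of 0]] xa by (metis (no_types, lifting) ext)
  then show False using ac by simp
qed

section \<open>A well with almost double critical points\<close>

text \<open>The double zero of \<open>(x - i)\<^sup>2\<close> at each \<open>i\<close> is removed by a small \<open>e\<close>, so that the force stays
  positive at \<open>i\<close> but is only of order \<open>e\<^sup>2\<close> within distance \<open>e\<close> of it.\<close>

definition bumps :: "nat \<Rightarrow> real \<Rightarrow> real poly" where
  "bumps k e = (\<Prod>i = 1..k. [:(real i)\<^sup>2 + e\<^sup>2, - 2 * real i, 1:])"

lemma poly_bumps: "poly (bumps k e) x = (\<Prod>i = 1..k. (x - real i)\<^sup>2 + e\<^sup>2)"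
  by (simp add: bumps_def poly_prod power2_eq_square algebra_simps)

lemma degree_bumps: "degree (bumps k e) = 2 * k"
proof -
  have "degree (bumps k e) = (\<Sum>i = 1..k. degree [:(real i)\<^sup>2 + e\<^sup>2, - 2 * real i, 1:])"
    unfolding bumps_def by (rule degree_prod_eq_sum_degree) simp
  then show ?thesis by simp
qed

lemma bumps_ge: "(e\<^sup>2) ^ k \<le> poly (bumps k e) x"
proof -
  have "(\<Prod>i = 1..k. e\<^sup>2) \<le> (\<Prod>i = 1..k. (x - real i)\<^sup>2 + e\<^sup>2)"
    by (intro prod_mono) simp
  then show ?thesis by (simp add: poly_bumps)
qed

lemma bumps_pos: "e \<noteq> 0 \<Longrightarrow> 0 < poly (bumps k e) x"
  unfolding poly_bumps by (intro prod_pos) (auto intro: add_nonneg_pos)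

lemma bumps_0_ge: "1 \<le> poly (bumps k e) 0"
  unfolding poly_bumps by (intro prod_ge_1) (auto intro: order_trans[OF _ le_add_same_cancel1[THEN iffD2]])

lemma bumps_antimono: assumes "a \<le> c" "c \<le> 0" shows "poly (bumps k e) c \<le> poly (bumps k e) a"
  unfolding poly_bumps
proof (intro prod_mono conjI)
  fix i
  have "(real i - c)\<^sup>2 \<le> (real i - a)\<^sup>2"
    using assms by (intro power_mono) auto
  then show "(c - real i)\<^sup>2 + e\<^sup>2 \<le> (a - real i)\<^sup>2 + e\<^sup>2" by (simp add: power2_commute)
qed simp

lemma bump_factor_le:
  assumes "0 \<le> x" "x \<le> real k + 1" "0 < e" "e \<le> 1" "i \<in> {1..k}"
  shows "(x - real i)\<^sup>2 + e\<^sup>2 \<le> (real k + 1)\<^sup>2 + 1"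
proof -
  have "\<bar>x - real i\<bar>\<^sup>2 \<le> (real k + 1)\<^sup>2"
    using assms by (intro power_mono) auto
  moreover have "e\<^sup>2 \<le> 1" using assms by (simp add: power_le_one)
  ultimately show ?thesis by simp
qed

lemma bumps_le:
  assumes "0 \<le> x" "x \<le> real k + 1" "0 < e" "e \<le> 1"
  shows "poly (bumps k e) x \<le> ((real k + 1)\<^sup>2 + 1) ^ k"
proof -
  have "(\<Prod>i = 1..k. (x - real i)\<^sup>2 + e\<^sup>2) \<le> (\<Prod>i = 1..k. (real k + 1)\<^sup>2 + 1)"
    by (intro prod_mono conjI bump_factor_le assms) auto
  then show ?thesis by (simp add: poly_bumps)
qed

lemma bumps_near_le:
  assumes x: "0 \<le> x" "x \<le> real k + 1" and e: "0 < e" "e \<le> 1" and j: "j \<in> {1..k}" "\<bar>x - real j\<bar> \<le> e"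
  shows "poly (bumps k e) x \<le> 2 * e\<^sup>2 * ((real k + 1)\<^sup>2 + 1) ^ k"
proof -
  let ?A = "(real k + 1)\<^sup>2 + 1"
  have "poly (bumps k e) x = ((x - real j)\<^sup>2 + e\<^sup>2) * (\<Prod>i\<in>{1..k} - {j}. (x - real i)\<^sup>2 + e\<^sup>2)"
    unfolding poly_bumps using j(1) by (simp add: prod.remove)
  also have "\<dots> \<le> (2 * e\<^sup>2) * ?A ^ k"
  proof (rule mult_mono)
    have "\<bar>x - real j\<bar>\<^sup>2 \<le> e\<^sup>2" using j(2) by (intro power_mono) auto
    then show "(x - real j)\<^sup>2 + e\<^sup>2 \<le> 2 * e\<^sup>2" by simp
    have "(\<Prod>i\<in>{1..k} - {j}. (x - real i)\<^sup>2 + e\<^sup>2) \<le> (\<Prod>i\<in>{1..k} - {j}. ?A)"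
      by (intro prod_mono conjI bump_factor_le x e) auto
    also have "\<dots> = ?A ^ (k - 1)" using j(1) by simp
    also have "\<dots> \<le> ?A ^ k" by (intro power_increasing) auto
    finally show "(\<Prod>i\<in>{1..k} - {j}. (x - real i)\<^sup>2 + e\<^sup>2) \<le> ?A ^ k" .
  qed (auto intro: prod_nonneg)
  finally show ?thesis .
qed

lemma bumps_between_ge:
  assumes "real j + 1 / 4 \<le> x" "x \<le> real j + 1 / 2"
  shows "(1 / 16) ^ k \<le> poly (bumps k e) x"
proof -
  have "(\<Prod>i = 1..k. 1 / 16 :: real) \<le> (\<Prod>i = 1..k. (x - real i)\<^sup>2 + e\<^sup>2)"
  proof (intro prod_mono conjI)
    fix i
    have "1 / 4 \<le> \<bar>x - real i\<bar>"
    proof (cases "i \<le> j")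
      case True
      then show ?thesis using assms by (simp add: abs_if)
    next
      case False
      then have "real j + 1 \<le> real i" by simp
      then show ?thesis using assms by (simp add: abs_if)
    qed
    then have "(1 / 4)\<^sup>2 \<le> \<bar>x - real i\<bar>\<^sup>2" by (intro power_mono) auto
    then show "1 / 16 \<le> (x - real i)\<^sup>2 + e\<^sup>2" by (simp add: power2_eq_square add_increasing2)
  qed simp
  then show ?thesis by (simp add: poly_bumps)
qed

text \<open>A bound of the force on \<open>0 \<le> x \<le> k + 1\<close>, uniform in \<open>e \<le> 1\<close>.\<close>

definition force_bound :: "nat \<Rightarrow> real" where
  "force_bound k = (real k + 1)\<^sup>2 * ((real k + 1)\<^sup>2 + 1) ^ k"

text \<open>The upper bound of \<open>period_upper_bound\<close> for the turning point \<open>j + 1/2\<close> and \<open>c = j + 1/4\<close>, made uniform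
  in \<open>j \<le> k\<close> and \<open>e \<le> 1\<close>. Here \<open>m\<close> is a lower bound of the force between the two points.\<close>

definition period_bound :: "nat \<Rightarrow> real" where
  "period_bound k = (let m = (1 / 16) ^ k / 8 in
     2 * ((real k + 1) / sqrt (m / 2) + sqrt (2 * (real k + 1) * force_bound k) / m + pi / 2))"

lemma force_bound_pos: "0 < force_bound k"
  by (auto simp: force_bound_def intro!: mult_pos_pos zero_less_power add_nonneg_pos)

lemma period_bound_nonneg: "0 \<le> period_bound k"
  using force_bound_pos[of k]
  by (auto simp: period_bound_def Let_def intro!: add_nonneg_nonneg divide_nonneg_nonneg)

text \<open>The factor \<open>q\<close> stands for \<open>1\<close> in odd degree and for \<open>k + 1 - x\<close> in even degree; the assumptions are
  the estimates that both have in common.\<close>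

locale bumpy_well = potential_well p X for p :: "real poly" and X :: "real set" +
  fixes k :: nat and e :: real and q :: "real poly"
  assumes p_eq: "p = bumps k e * q" and e: "0 < e" "e \<le> 1"
    and q_0: "1 \<le> poly q 0"
    and q_antimono: "a \<le> c \<Longrightarrow> c \<le> 0 \<Longrightarrow> poly q c \<le> poly q a"
    and q_ge: "0 \<le> x \<Longrightarrow> x \<le> real k + 1 / 2 \<Longrightarrow> 1 / 2 \<le> poly q x"
    and q_le: "0 \<le> x \<Longrightarrow> x \<le> real k + 1 \<Longrightarrow> poly q x \<le> real k + 1"
    and q_nonneg: "0 \<le> x \<Longrightarrow> x \<le> real k + 1 \<Longrightarrow> 0 \<le> poly q x"
    and range_X: "0 \<le> x \<Longrightarrow> x < real k + 1 \<Longrightarrow> x \<in> X"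
begin

lemma force_le:
  assumes "0 \<le> x" "x \<le> real k + 1"
  shows "x * poly p x \<le> force_bound k"
proof -
  have "x * (poly (bumps k e) x * poly q x) \<le> (real k + 1) * (((real k + 1)\<^sup>2 + 1) ^ k * (real k + 1))"
    using bumps_le[OF assms e] q_le[OF assms] q_nonneg[OF assms] assms bumps_pos[of e k x] e
    by (intro mult_mono mult_nonneg_nonneg) auto
  then show ?thesis
    by (simp add: p_eq force_bound_def power2_eq_square mult_ac)
qed

lemma force_nonneg: "0 \<le> x \<Longrightarrow> x < real k + 1 \<Longrightarrow> 0 \<le> x * poly p x"
  using p_pos[OF range_X[of x]] by simp

lemma force_near_le:
  assumes x: "0 \<le> x" "x \<le> real k + 1" and j: "j \<in> {1..k}" "\<bar>x - real j\<bar> \<le> e"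
  shows "x * poly p x \<le> 2 * e\<^sup>2 * force_bound k"
proof -
  have "x * (poly (bumps k e) x * poly q x) \<le>
      (real k + 1) * ((2 * e\<^sup>2 * ((real k + 1)\<^sup>2 + 1) ^ k) * (real k + 1))"
    using bumps_near_le[OF x e j] q_le[OF x] q_nonneg[OF x] x bumps_pos[of e k x] e
    by (intro mult_mono mult_nonneg_nonneg) auto
  then show ?thesis
    by (simp add: p_eq force_bound_def power2_eq_square mult_ac)
qed

lemma force_ge:
  assumes x: "real j + 1 / 4 \<le> x" "x \<le> real j + 1 / 2" and j: "j \<le> k"
  shows "(1 / 16) ^ k / 8 \<le> x * poly p x"
proof -
  have "0 \<le> x" "x \<le> real k + 1 / 2" "1 / 4 \<le> x" using assms by auto
  then have "(1 / 4) * ((1 / 16) ^ k * (1 / 2)) \<le> x * (poly (bumps k e) x * poly q x)"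
    using bumps_between_ge[OF x, of k e] q_ge[of x] bumps_pos[of e k x] e
    by (intro mult_mono mult_nonneg_nonneg) auto
  then show ?thesis by (simp add: p_eq)
qed

text \<open>The turning point \<open>j + 1/2\<close> keeps distance \<open>1/4\<close> from the bumps during the final approach, and the
  bumps on the way are passed with a velocity bounded from below.\<close>

lemma period_at_half_integer:
  assumes j: "j \<le> k"
  shows "T (\<psi> (real j + 1 / 2)) \<le> period_bound k"
proof -
  let ?b = "real j + 1 / 2" and ?c = "real j + 1 / 4"
  let ?m = "(1 / 16 :: real) ^ k / 8" and ?M = "force_bound k"
  let ?\<eta> = "sqrt (2 * (potential p ?b - potential p ?c))"
  have bX: "?b \<in> X" using j by (intro range_X) auto
  have m: "0 < ?m" by simp
  have p0: "1 \<le> poly p 0"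
    using bumps_0_ge[of k e] q_0 mult_mono[of 1 "poly (bumps k e) 0" 1 "poly q 0"] by (simp add: p_eq)
  have anti: "poly p c \<le> poly p a" if "a \<le> c" "c \<le> 0" for a c
  proof -
    have "0 \<le> poly q c" using q_antimono[of c 0] that q_0 by simp
    then show ?thesis
      using bumps_antimono[OF that, of k e] q_antimono[OF that] bumps_pos[of e k] e
      by (auto simp: p_eq less_imp_le intro!: mult_mono)
  qed
  have "T (\<psi> ?b) \<le> 2 * (?c / ?\<eta> + ?\<eta> / ?m + pi / (2 * sqrt 1))"
    by (rule period_upper_bound[OF bX]) (use m p0 anti force_ge j in auto)
  also have "\<dots> \<le> 2 * ((real k + 1) / sqrt (?m / 2) + sqrt (2 * (real k + 1) * ?M) / ?m + pi / 2)"
  proof -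
    have "?m * (?b - ?c) \<le> potential p ?b - potential p ?c"
      by (rule potential_diff_bounds(1)[where M = ?M]) (use force_ge j force_le in auto)
    then have "sqrt (?m / 2) \<le> ?\<eta>" by (intro real_sqrt_le_mono) simp
    then have 1: "?c / ?\<eta> \<le> (real k + 1) / sqrt (?m / 2)"
      using j m by (intro frac_le) auto
    have "0 \<le> potential p ?c" using potential_pos[of ?c] range_X[of ?c] j by simp
    moreover have "potential p ?b - potential p 0 \<le> ?M * (?b - 0)"
      by (rule potential_diff_bounds(2)[where m = 0])
         (use j force_le force_nonneg in auto)
    moreover have "?M * ?b \<le> ?M * (real k + 1)"
      using j force_bound_pos[of k] by (intro mult_left_mono) auto
    ultimately have "?\<eta> \<le> sqrt (2 * (real k + 1) * ?M)"
      by (intro real_sqrt_le_mono) (simp add: algebra_simps)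
    then have 2: "?\<eta> / ?m \<le> sqrt (2 * (real k + 1) * ?M) / ?m"
      using m by (intro divide_right_mono) auto
    show ?thesis by (intro mult_left_mono add_mono 1 2) auto
  qed
  finally show ?thesis by (simp add: period_bound_def Let_def)
qed

text \<open>On the last stretch from \<open>j - e\<close> to the turning point \<open>j\<close> the force is of order \<open>e\<^sup>2\<close>, so the
  velocity is of order \<open>e * sqrt e\<close> and the passage of length \<open>e\<close> takes a time of order \<open>1 / sqrt e\<close>.\<close>

lemma period_at_integer:
  assumes j: "j \<in> {1..k}"
  shows "1 / sqrt (force_bound k * e) \<le> T (\<psi> (real j))"
proof -
  let ?M = "force_bound k"
  let ?s = "2 * e * sqrt (?M * e)"
  have M: "0 < ?M" by (rule force_bound_pos)
  have s: "0 < ?s" using M e by simp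
  have "2 * (real j / ?s - (real j - e) / ?s) \<le> T (\<psi> (real j))"
  proof (rule period_lower_bound[where W = "\<lambda>x. x / ?s" and W' = "\<lambda>_. 1 / ?s"])
    show "real j \<in> X" using j by (intro range_X) auto
    show "0 \<le> real j - e" using j e by simp
    show "real j - e < real j" using e by simp
    show "((\<lambda>x. x / ?s) has_real_derivative 1 / ?s) (at x)" for x
      by (intro DERIV_cdivide DERIV_ident)
    fix x assume x: "real j - e \<le> x" "x \<le> real j"
    have x0: "0 \<le> x" using x j e by (smt (verit) atLeastAtMost_iff of_nat_1 of_nat_le_iff)
    have "potential p (real j) - potential p x \<le> 2 * e\<^sup>2 * ?M * (real j - x)"
    proof (rule potential_diff_bounds(2)[OF x(2), where m = 0])
      fix y assume y: "x \<le> y" "y \<le> real j"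
      have y': "0 \<le> y" "y \<le> real k + 1" "y < real k + 1" using x0 j y by auto
      show "0 \<le> y * poly p y" by (rule force_nonneg[OF y'(1,3)])
      show "y * poly p y \<le> 2 * e\<^sup>2 * ?M"
        by (rule force_near_le[OF y'(1,2) j]) (use x y in auto)
    qed
    also have "\<dots> \<le> 2 * e\<^sup>2 * ?M * e"
      using x M e by (intro mult_left_mono) auto
    finally have "2 * (potential p (real j) - potential p x) \<le> ?s\<^sup>2"
      using M e by (simp add: power_mult_distrib power2_eq_square algebra_simps)
    then have "sqrt (2 * (potential p (real j) - potential p x)) \<le> ?s"
      using s by (simp add: real_le_lsqrt)
    then show "1 / ?s * sqrt (2 * (potential p (real j) - potential p x)) \<le> 1"
      using s by (simp add: divide_le_eq)
  qed simp
  also have "2 * (real j / ?s - (real j - e) / ?s) = 1 / sqrt (?M * e)"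
    using e M by (simp add: field_simps)
  finally show ?thesis .
qed

text \<open>The turning points \<open>1/2, 1, 3/2, \<dots>, k + 1/2\<close> alternate between moderate and long periods; a turning
  point \<open>b\<close> beyond them with a long period may be appended.\<close>

lemma num_critical_periods_bumpy_well:
  assumes frontier: "\<And>\<gamma>. periodic_orbit F \<gamma> \<Longrightarrow> \<gamma> \<inter> frontier region = {}"
    and small: "force_bound k * e * (period_bound k)\<^sup>2 < 1"
    and last: "L = 2 * k \<or> (L = 2 * k + 1 \<and> real k + 1 / 2 < b \<and> b \<in> X \<and> period_bound k < T (\<psi> b))"
  shows "enat (L - 1) \<le> num_critical_periods (pCons 0 p)"
proof (rule num_critical_periods_ge_of_oscillation_at_amplitudes[OF frontier])
  let ?b = "\<lambda>i. if i \<le> 2 * k then (real i + 1) / 2 else b"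
  have high: "period_bound k < T (\<psi> (real j))" if j: "j \<in> {1..k}" for j
  proof -
    have "0 < force_bound k * e" using force_bound_pos e by simp
    moreover have "(period_bound k * sqrt (force_bound k * e))\<^sup>2 < 1\<^sup>2"
      using small force_bound_pos[of k] e by (simp add: power_mult_distrib mult_ac)
    then have "period_bound k * sqrt (force_bound k * e) < 1"
      by (rule power_less_imp_less_base) simp
    ultimately have "period_bound k < 1 / sqrt (force_bound k * e)"
      by (simp add: less_divide_eq)
    then show ?thesis using period_at_integer[OF j] by simp
  qed
  show "?b l \<in> X" if "l \<le> L" for l
    using that last by (auto intro!: range_X)
  show "0 < ?b l" if "l \<le> L" for l
    using that last by (auto intro: less_trans[of 0 "real k + 1 / 2"])
  show "?b l < ?b (Suc l)" if "l < L" for l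
    using that last by (auto simp: not_le)
  show "T (\<psi> (?b l)) \<le> period_bound k" if "l \<le> L" "even l" for l
  proof -
    from that(2) obtain j where j: "l = 2 * j" by (elim evenE)
    then have "j \<le> k" using that last by auto
    then show ?thesis using period_at_half_integer[of j] j by (simp add: add_divide_distrib)
  qed
  show "period_bound k < T (\<psi> (?b l))" if "l \<le> L" "odd l" for l
  proof (cases "l \<le> 2 * k")
    case True
    from that(2) obtain j where j: "l = 2 * j + 1" by (elim oddE)
    then have "j + 1 \<in> {1..k}" using True by auto
    from high[OF this] show ?thesis using j True by (simp add: add_divide_distrib add.commute)
  next
    case False
    then show ?thesis using that last by auto
  qed
qed

end

section \<open>The potential systems of odd and of even degree\<close>

text \<open>With \<open>\<sigma> = 1\<close> on the right and \<open>\<sigma> = -1\<close> on the left of the center: if \<open>p\<close> is bounded away from zero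
  there, the potential grows at least quadratically and attains every energy.\<close>

lemma potential_attains:
  assumes \<sigma>: "\<sigma> = 1 \<or> \<sigma> = -1" and \<mu>: "0 < \<mu>" "\<And>t. 0 \<le> \<sigma> * t \<Longrightarrow> \<mu> \<le> poly p t" and h: "0 \<le> h"
  shows "\<exists>z. 0 \<le> \<sigma> * z \<and> potential p z = h"
proof -
  let ?N = "sqrt (2 * h / \<mu>)"
  have N: "0 \<le> ?N" using \<mu>(1) h by simp
  have "\<mu> * (\<sigma> * ?N)\<^sup>2 / 2 \<le> potential p (\<sigma> * ?N)"
  proof (rule potential_ge_quadratic)
    fix t assume "\<bar>t\<bar> \<le> \<bar>\<sigma> * ?N\<bar>" "0 \<le> t * (\<sigma> * ?N)"
    then have "0 \<le> \<sigma> * t"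
      using N \<sigma> by (cases "?N = 0") (auto simp: zero_le_mult_iff mult_le_0_iff)
    then show "\<mu> \<le> poly p t" by (rule \<mu>(2))
  qed
  moreover have "\<mu> * (\<sigma> * ?N)\<^sup>2 / 2 = h"
    using \<sigma> \<mu>(1) h by (auto simp: power_mult_distrib)
  ultimately have "\<exists>s\<ge>0. s \<le> ?N \<and> potential p (\<sigma> * s) = h"
    using h N by (intro IVT') (auto intro!: continuous_on_compose2[OF potential_continuous[of UNIV]] continuous_intros)
  then obtain s where "0 \<le> s" "potential p (\<sigma> * s) = h" by blast
  then show ?thesis using \<sigma> by (intro exI[of _ "\<sigma> * s"]) (auto simp flip: mult.assoc)
qed

lemma small_parameter_exists:
  fixes M B :: real assumes "0 < M"
  shows "\<exists>e. 0 < e \<and> e \<le> 1 \<and> M * e * B\<^sup>2 < 1"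
proof -
  have "0 \<le> M * B\<^sup>2" using assms by simp
  then show ?thesis
    by (intro exI[of _ "1 / (1 + M * B\<^sup>2)"]) (simp add: field_simps)
qed

text \<open>Without further factor the well is the whole line and all orbits are periodic.\<close>

lemma odd_degree_case:
  "\<exists>g. degree g = 2 * k + 1 \<and> is_center (potential_field g) 0 \<and> enat (2 * k - 1) \<le> num_critical_periods g"
proof -
  obtain e where e: "0 < e" "e \<le> 1" and small: "force_bound k * e * (period_bound k)\<^sup>2 < 1"
    using small_parameter_exists[OF force_bound_pos] by blast
  define p where "p = bumps k e"
  have \<mu>: "0 < (e\<^sup>2) ^ k" "(e\<^sup>2) ^ k \<le> poly p t" for t
    using e bumps_ge by (auto simp: p_def)
  interpret bumpy_well p UNIV k e 1
  proof
    show "0 < poly p x" for x using \<mu>(1) \<mu>(2)[of x] by linarith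
    then have nonneg: "0 \<le> potential p x" for x
      using potential_ge_quadratic[of x 0 p] by (auto simp: less_imp_le)
    show "\<exists>z\<in>UNIV. x * z \<le> 0 \<and> potential p z = potential p x" for x
    proof (cases "0 \<le> x")
      case True
      then show ?thesis
        using potential_attains[of "-1", OF _ \<mu> nonneg[of x]] by (auto simp: mult_le_0_iff)
    next
      case False
      then show ?thesis
        using potential_attains[of 1, OF _ \<mu> nonneg[of x]] by (auto simp: mult_le_0_iff)
    qed
  qed (use e in \<open>auto simp: p_def\<close>)
  have UNIV: "region = UNIV"
  proof -
    have "s \<in> J" if "0 \<le> s" for s
    proof -
      obtain z where z: "0 \<le> z" "potential p z = s\<^sup>2 / 2"
        using potential_attains[of 1, OF _ \<mu>, of "s\<^sup>2 / 2"] by auto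
      then have "(\<psi> z)\<^sup>2 = s\<^sup>2" using \<psi>_square[of z] by simp
      moreover have "0 \<le> \<psi> z" using \<psi>_neg_iff[of z] z(1) by auto
      ultimately have "\<psi> z = s" using that by (simp add: power2_eq_iff_nonneg)
      then show ?thesis using \<psi>_in_J[of z] by simp
    qed
    then show ?thesis by (auto simp: region_def)
  qed
  have "enat (2 * k - 1) \<le> num_critical_periods (pCons 0 p)"
    by (rule num_critical_periods_bumpy_well[OF _ small]) (auto simp: UNIV)
  moreover have "degree (pCons 0 p) = 2 * k + 1"
  proof -
    have "p \<noteq> 0" using \<mu>(1) \<mu>(2)[of 0] by auto
    then show ?thesis by (simp add: p_def degree_bumps)
  qed
  ultimately show ?thesis using is_center by blast
qed

text \<open>The factor \<open>c - x\<close> puts a saddle at \<open>c = k + 1\<close>. The well ends there on the right, and on the left at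
  the point \<open>a\<close> of equal energy. Close to the saddle the velocity is at most \<open>A * (c - x)\<close>, so
  the time to reach the turning point \<open>c - \<delta>\<close> is at least of order \<open>- ln \<delta>\<close>.\<close>

lemma even_degree_case:
  "\<exists>g. degree g = 2 * k + 2 \<and> is_center (potential_field g) 0 \<and> enat (2 * k) \<le> num_critical_periods g"
proof -
  obtain e where e: "0 < e" "e \<le> 1" and small: "force_bound k * e * (period_bound k)\<^sup>2 < 1"
    using small_parameter_exists[OF force_bound_pos] by blast
  define c where "c = real k + 1"
  define q where "q = [:c, -1:]"
  define p where "p = bumps k e * q"
  have c: "1 \<le> c" by (simp add: c_def)
  have poly_p: "poly p x = poly (bumps k e) x * (c - x)" for x
    by (simp add: p_def q_def algebra_simps)
  have p_pos: "0 < poly p x" if "x < c" for x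
    using bumps_pos[of e k x] e that by (simp add: poly_p)
  have p_left: "1 \<le> poly p x" if "x \<le> 0" for x
  proof -
    have "1 \<le> poly (bumps k e) x"
      using bumps_0_ge[of k e] bumps_antimono[of x 0 k e] that by simp
    then show ?thesis
      using mult_mono[of 1 "poly (bumps k e) x" 1 "c - x"] that c by (simp add: poly_p)
  qed
  have incr: "potential p x < potential p y" if "0 \<le> x" "x < y" "y \<le> c" for x y
    by (rule DERIV_pos_imp_increasing_open[OF that(2)])
       (use that p_pos potential_DERIV potential_continuous in \<open>force intro!: exI mult_pos_pos\<close>)+
  have decr: "potential p y < potential p x" if "x < y" "y \<le> 0" for x y
    by (rule DERIV_neg_imp_decreasing_open[OF that(1)])
       (use that c p_pos potential_DERIV potential_continuous in \<open>force intro!: exI mult_neg_pos\<close>)+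
  have potc: "0 < potential p c" using incr[of 0 c] c by simp
  obtain a where a: "a < 0" "potential p a = potential p c"
  proof -
    obtain a where "0 \<le> -1 * a" "potential p a = potential p c"
      using potential_attains[of "-1" 1 p "potential p c"] p_left potc by auto
    then show thesis using that[of a] potc by (cases "a = 0") auto
  qed
  define X where "X = {a<..<c}"
  have X_iff: "x \<in> X \<longleftrightarrow> a < x \<and> x < c" for x by (simp add: X_def)
  have inside: "potential p x < potential p c" if "a < x" "x < c" for x
    using that incr[of x c] decr[of a x] a by (cases "0 \<le> x") auto
  have outside: "potential p c < potential p x" if "x < a" for x
    using decr[of x a] that a by simp
  have contp: "continuous_on S (potential p)" for S by (rule potential_continuous)
  have right_preimage: "\<exists>z. 0 \<le> z \<and> z < c \<and> potential p z = h" if h: "0 \<le> h" "h < potential p c" for h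
  proof -
    have "\<exists>z\<ge>0. z \<le> c \<and> potential p z = h"
      by (rule IVT') (use h c contp in auto)
    then show ?thesis using h by (metis less_irrefl order_le_less)
  qed
  have left_preimage: "\<exists>z. a < z \<and> z \<le> 0 \<and> potential p z = h" if h: "0 \<le> h" "h < potential p c" for h
  proof -
    have "\<exists>z\<ge>a. z \<le> 0 \<and> potential p z = h"
      by (rule IVT2') (use h a contp in auto)
    then show ?thesis using h a by (metis less_irrefl order_le_less)
  qed
  have pot_nonneg: "0 \<le> potential p x" if "a < x" "x < c" for x
    using that incr[of 0 x] decr[of x 0] by (cases x "0 :: real" rule: linorder_cases) auto
  interpret bumpy_well p X k e q
  proof
    show "\<exists>z\<in>X. x * z \<le> 0 \<and> potential p z = potential p x" if "x \<in> X" for x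
    proof (cases "0 \<le> x")
      case True
      then show ?thesis
        using that left_preimage[of "potential p x", OF pot_nonneg inside] c
        by (force simp: X_iff mult_le_0_iff)
    next
      case False
      then show ?thesis
        using that right_preimage[of "potential p x", OF pot_nonneg inside] a
        by (force simp: X_iff mult_le_0_iff)
    qed
    show "p = bumps k e * q" by (simp add: p_def)
  qed (use e a c p_pos in \<open>auto simp: X_def q_def c_def\<close>)

  \<comment> \<open>Points of the region lie strictly below the energy of the saddle, so those of its frontier lie on the loop.\<close>
  have region_eq: "region = {(x, y). x \<in> X \<and> y\<^sup>2 / 2 + potential p x < potential p c}"
  proof -
    have "norm (\<psi> x, y) \<in> J \<longleftrightarrow> y\<^sup>2 / 2 + potential p x < potential p c" if x: "x \<in> X" for x y
    proof -
      let ?r = "norm (\<psi> x, y)"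
      have r: "?r\<^sup>2 / 2 = y\<^sup>2 / 2 + potential p x"
      proof -
        have "?r\<^sup>2 = (\<psi> x)\<^sup>2 + y\<^sup>2" by (simp add: norm_Pair)
        then show ?thesis using \<psi>_square[OF x] by simp
      qed
      show ?thesis
      proof
        assume "?r \<in> J"
        then obtain z where z: "z \<in> X" "?r = \<psi> z" by (auto simp: J_def)
        then have "?r\<^sup>2 / 2 = potential p z" using \<psi>_square by simp
        then show "y\<^sup>2 / 2 + potential p x < potential p c"
          using inside[of z] z r by (simp add: X_iff)
      next
        assume "y\<^sup>2 / 2 + potential p x < potential p c"
        then have less: "?r\<^sup>2 / 2 < potential p c" unfolding r .
        have "0 \<le> ?r\<^sup>2 / 2" by (intro divide_nonneg_pos zero_le_power2) simp
        from right_preimage[OF this less]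
        obtain z where z: "0 \<le> z" "z < c" "potential p z = ?r\<^sup>2 / 2" by blast
        then have zX: "z \<in> X" using a by (simp add: X_iff)
        then have "(\<psi> z)\<^sup>2 = ?r\<^sup>2" using \<psi>_square z by simp
        moreover have "0 \<le> \<psi> z" using \<psi>_neg_iff[OF zX] z(1) by auto
        ultimately have "\<psi> z = ?r" by (simp add: power2_eq_iff_nonneg)
        then show "?r \<in> J" using \<psi>_in_J[OF zX] by simp
      qed
    qed
    then show ?thesis by (auto simp: region_def)
  qed
  have frontier_sub: "x \<le> c \<and> y\<^sup>2 / 2 + potential p x = potential p c" if "(x, y) \<in> frontier region" for x y
  proof -
    let ?C = "{q. a \<le> fst q} \<inter> {q. fst q \<le> c} \<inter> {q. (snd q)\<^sup>2 / 2 + potential p (fst q) \<le> potential p c}"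
    have "continuous_on UNIV (\<lambda>q :: real \<times> real. potential p (fst q))"
      by (rule continuous_on_compose2[OF contp[of UNIV]]) (auto intro!: continuous_intros)
    then have "closed ?C"
      by (intro closed_Int closed_Collect_le continuous_intros) auto
    moreover have "region \<subseteq> ?C" by (auto simp: region_eq X_iff)
    ultimately have "closure region \<subseteq> ?C" by (rule closure_minimal[rotated])
    then have C: "a \<le> x" "x \<le> c" "y\<^sup>2 / 2 + potential p x \<le> potential p c"
      using that by (auto simp: frontier_def)
    have "(x, y) \<notin> region"
      using that open_region by (simp add: frontier_def interior_open)
    then have "y\<^sup>2 / 2 + potential p x = potential p c"
      using C a by (cases "x = a \<or> x = c") (auto simp: region_eq X_iff)
    then show ?thesis using C by blast
  qed
  have frontier: "\<gamma> \<inter> frontier region = {}" if \<gamma>: "periodic_orbit F \<gamma>" for \<gamma>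
  proof (rule ccontr)
    assume "\<gamma> \<inter> frontier region \<noteq> {}"
    then obtain x y where xy: "(x, y) \<in> \<gamma>" "(x, y) \<in> frontier region" by auto
    show False
    proof (rule no_periodic_orbit_on_homoclinic_loop[OF _ a(1) _ _ a(2) inside outside \<gamma> xy(1)])
      show "poly p c = 0" by (simp add: poly_p)
      show "poly p a \<noteq> 0" using p_left[of a] a(1) by simp
    qed (use frontier_sub[OF xy(2)] c in auto)
  qed

  define A where "A = sqrt (2 * force_bound k)"
  \<comment> \<open>The half turn from \<open>c - 1/2\<close> to \<open>c - \<delta>\<close> lasts at least \<open>- ln (2 * \<delta>) / A = period_bound k + 1 / A\<close>.\<close>
  define \<delta> where "\<delta> = exp (- (A * period_bound k + 1)) / 2"
  have A: "0 < A" using force_bound_pos by (simp add: A_def)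
  have "0 \<le> A * period_bound k"
    using A period_bound_nonneg[of k] by simp
  then have \<delta>: "0 < \<delta>" "\<delta> < 1 / 2"
    by (simp_all add: \<delta>_def)
  have bX: "c - \<delta> \<in> X" using \<delta> a c by (simp add: X_iff)
  have "2 * (- ln (c - (c - \<delta>)) / A - - ln (c - (c - 1 / 2)) / A) \<le> T (\<psi> (c - \<delta>))"
  proof (rule period_lower_bound[OF bX, where W = "\<lambda>x. - ln (c - x) / A" and W' = "\<lambda>x. 1 / (A * (c - x))"])
    fix x assume x: "c - 1 / 2 \<le> x" "x \<le> c - \<delta>"
    have xc: "0 < c - x" using x \<delta> by simp
    have x0: "0 \<le> x" using x c by simp
    show "((\<lambda>x. - ln (c - x) / A) has_real_derivative 1 / (A * (c - x))) (at x)"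
      using xc A by (auto intro!: derivative_eq_intros simp: field_simps)
    have less: "potential p (c - \<delta>) < potential p c" using bX by (intro inside) (auto simp: X_iff)
    have le: "potential p c - potential p x \<le> (force_bound k * (c - x)) * (c - x)"
    proof (rule potential_diff_bounds(2)[where m = 0])
      fix y assume y: "x \<le> y" "y \<le> c"
      then have y': "0 \<le> y" "y \<le> real k + 1" using x0 by (auto simp: c_def)
      have "0 \<le> poly (bumps k e) y" using bumps_pos[of e k y] e by simp
      then show "0 \<le> y * poly p y" using y y' by (simp add: poly_p)
      have "y * poly (bumps k e) y \<le> (real k + 1) * ((real k + 1)\<^sup>2 + 1) ^ k"
        using y' bumps_le[OF y' e] \<open>0 \<le> poly (bumps k e) y\<close> by (intro mult_mono) auto
      also have "\<dots> \<le> (real k + 1)\<^sup>2 * ((real k + 1)\<^sup>2 + 1) ^ k"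
        by (intro mult_right_mono) (auto simp: power2_eq_square)
      finally have "(y * poly (bumps k e) y) * (c - y) \<le> force_bound k * (c - x)"
        using y y' \<open>0 \<le> poly (bumps k e) y\<close> force_bound_pos[of k]
        by (intro mult_mono) (auto simp: force_bound_def)
      then show "y * poly p y \<le> force_bound k * (c - x)" by (simp add: poly_p mult_ac)
    qed (use xc in simp)
    have "2 * (potential p (c - \<delta>) - potential p x) \<le> 2 * ((force_bound k * (c - x)) * (c - x))"
      by (intro mult_left_mono order_trans[OF _ le]) (use less in auto)
    also have "\<dots> = (A * (c - x))\<^sup>2"
      using force_bound_pos[of k] by (simp add: A_def power_mult_distrib) (simp add: power2_eq_square)
    finally have "2 * (potential p (c - \<delta>) - potential p x) \<le> (A * (c - x))\<^sup>2" .
    then have "sqrt (2 * (potential p (c - \<delta>) - potential p x)) \<le> A * (c - x)"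
      using A xc by (simp add: real_le_lsqrt)
    then show "1 / (A * (c - x)) * sqrt (2 * (potential p (c - \<delta>) - potential p x)) \<le> 1"
      using A xc by (simp add: divide_le_eq)
  qed (use \<delta> c in auto)
  moreover have "ln \<delta> = - (A * period_bound k + 1) + ln (1 / 2)"
    by (simp add: \<delta>_def ln_div)
  ultimately have "2 * ((A * period_bound k + 1) / A) \<le> T (\<psi> (c - \<delta>))"
    by (simp add: diff_divide_distrib[symmetric] add_divide_distrib[symmetric] add.commute)
  moreover have "period_bound k < 2 * ((A * period_bound k + 1) / A)"
  proof -
    have "0 < 2 / A" using A by simp
    moreover have "2 * ((A * period_bound k + 1) / A) = 2 * period_bound k + 2 / A"
      using A by (simp add: field_simps)
    ultimately show ?thesis using period_bound_nonneg[of k] by linarith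
  qed
  ultimately have "period_bound k < T (\<psi> (c - \<delta>))" by linarith
  then have "enat (2 * k + 1 - 1) \<le> num_critical_periods (pCons 0 p)"
    by (intro num_critical_periods_bumpy_well[OF frontier small, of "2 * k + 1" "c - \<delta>"])
       (use bX \<delta> in \<open>auto simp: c_def\<close>)
  moreover have "degree (pCons 0 p) = 2 * k + 2"
  proof -
    have nz: "bumps k e \<noteq> 0" "q \<noteq> 0" using bumps_0_ge[of k e] by (auto simp: q_def)
    then have "degree p = 2 * k + 1"
      unfolding p_def by (simp add: degree_mult_eq degree_bumps) (simp add: q_def)
    moreover have "p \<noteq> 0" unfolding p_def using nz by simp
    ultimately show ?thesis by simp
  qed
  ultimately show ?thesis using is_center by (intro exI[of _ "pCons 0 p"]) simp
qed

theorem theorem1p1: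
  fixes n :: nat
  assumes "n \<ge> 1"
  shows "\<exists>g :: real poly. degree g = n \<and> is_center (potential_field g) 0 \<and>
           num_critical_periods g \<ge> enat (n - 2)"
proof (cases "odd n")
  case True
  then obtain k where "n = 2 * k + 1" by (elim oddE)
  then show ?thesis using odd_degree_case[of k] by simp
next
  case False
  then obtain k where "n = 2 * k" by auto
  with assms have "n = 2 * (k - 1) + 2" by simp
  then show ?thesis using even_degree_case[of "k - 1"] by simp
qed

end
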